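(* Consider a four-round bit-commitment based coin-flipping protocol with parameters $\alpha_0,\alpha_1\in\mathrm{Prob}^A$ and $\beta_0,\beta_1\in\mathrm{Prob}^B$, where $A,B$ are finite sets. (i) If $|A|=|B|=2$ (qubit messages), then $\max\{P_{\mathrm A,0}^*,P_{\mathrm B,0}^*\}\ge 0.7487$; in particular the protocol has bias at least $0.2487$. (ii) If $|B|=2$ and $|A|\neq 2$, then $\max\{P_{\mathrm A,0}^*,P_{\mathrm B,0}^*\}\ge 0.7140$. (iii) If $|A|=2$ and $|B|\neq 2$, then $\max\{P_{\mathrm A,0}^*,P_{\mathrm B,0}^*\}\ge 0.7040$.
   Context: Notation. For a finite set $S$, $\mathrm{Prob}^S$ is the set of probability vectors indexed by $S$ and $e_x$ ($x\in S$) are the standard basis vectors. $\oplus$ is XOR of bits. Protocol (four rounds). Let $A'=A$ and $B'=B$ be copies, and $A_0=A_0'=B_0=B_0'=\{0,1\}$; a set is used as a label for the quantum register with state space $\mathbb{C}^{\text{set}}$. Put $\psi_a=\sum_{x\in A}\sqrt{\alpha_{a,x}}\,e_x\otimes e_x\in\mathbb{C}^A\otimes\mathbb{C}^{A'}$, $\psi=\sum_{a\in\{0,1\}}\frac{1}{\sqrt2}e_a\otimes e_a\otimes\psi_a\in\mathbb{C}^{A_0}\otimes\mathbb{C}^{A_0'}\otimes\mathbb{C}^A\otimes\mathbb{C}^{A'}$, $\phi_b=\sum_{y\in B}\sqrt{\beta_{b,y}}\,e_y\otimes e_y\in\mathbb{C}^B\otimes\mathbb{C}^{B'}$, $\phi=\sum_{b\in\{0,1\}}\frac{1}{\sqrt2}e_b\otimes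 e_b\otimes\phi_b\in\mathbb{C}^{B_0}\otimes\mathbb{C}^{B_0'}\otimes\mathbb{C}^B\otimes\mathbb{C}^{B'}$. Alice prepares $\psi$ and Bob prepares $\phi$. Alice sends $\mathbb{C}^A$ to Bob, who replies with $\mathbb{C}^B$. Then Alice sends $\mathbb{C}^{A_0'}$ and $\mathbb{C}^{A'}$ to Bob, and then Bob sends $\mathbb{C}^{B_0'}$ and $\mathbb{C}^{B'}$ to Alice. Finally Alice measures registers $A_0,B_0',B,B'$ with the POVM $(\Pi_{\mathrm A,0},\Pi_{\mathrm A,1},\Pi_{\mathrm A,\mathrm{abort}})$, where $\Pi_{\mathrm A,c}=\sum_{b\in\{0,1\}}e_{b\oplus c}e_{b\oplus c}^*\otimes e_be_b^*\otimes\phi_b\phi_b^*$ and $\Pi_{\mathrm A,\mathrm{abort}}=\mathrm I-\Pi_{\mathrm A,0}-\Pi_{\mathrm A,1}$; Bob measures registers $B_0,A_0',A,A'$ with $(\Pi_{\mathrm B,0},\Pi_{\mathrm B,1},\Pi_{\mathrm B,\mathrm{abort}})$, where $\Pi_{\mathrm B,c}=\sum_{a\in\{0,1\}}e_{a\oplus c}e_{a\oplus c}^*\otimes e_ae_a^*\otimes\psi_a\psi_a^*$ and $\Pi_{\mathrm B,\mathrm{abort}}=\mathrm I-\Pi_{\mathrm B,0}-\Pi_{\mathrm B,1}$. The measurement outcome is the party's output. Cheating and bias. A cheating party may use a private workspace of arbitrary finite dimension, an arbitrary initial state (unentangled with the honest party), arbitrary quantum operations on the qubits in its possession between messages, and an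 arbitrary final measurement; the only restriction is that its messages have the dimensions prescribed by the protocol. The other party follows the protocol. $P_{\mathrm A,c}^*$ is the supremum, over all cheating strategies of Alice, of the probability that honest Bob outputs $c$; $P_{\mathrm B,c}^*$ is the supremum, over all cheating strategies of Bob, of the probability that honest Alice outputs $c$. The bias is $\max\{P_{\mathrm A,0}^*,P_{\mathrm A,1}^*,P_{\mathrm B,0}^*,P_{\mathrm B,1}^*\}-\frac12$. *)

theory Defs
  imports Complex_Main "HOL-Library.Z2" "HOL-Library.Nonpos_Ints"
begin

section \<open>Vectors and operators indexed by finite sets\<close>

text \<open>
  A vector of \<open>\<complex>\<^sup>S\<close> is a function on index labels, and an operator is a matrix given as a function
  of two labels. Only the values at labels in the stated finite carrier sets matter; every sum is
  taken over such a carrier. A composite register has pairs as labels.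
\<close>

type_synonym 'i vec = "'i \<Rightarrow> complex"
type_synonym ('i, 'j) matr = "'i \<Rightarrow> 'j \<Rightarrow> complex"
type_synonym 'i oper = "('i, 'i) matr"

definition Prob :: "'i set \<Rightarrow> ('i \<Rightarrow> real) set" where
  "Prob S = {p. (\<forall>x\<in>S. 0 \<le> p x) \<and> (\<Sum>x\<in>S. p x) = 1}"

definition basis :: "'i \<Rightarrow> 'i vec" where
  "basis x = (\<lambda>y. if y = x then 1 else 0)"

definition tensor_vec :: "'i vec \<Rightarrow> 'j vec \<Rightarrow> ('i \<times> 'j) vec"  (infixr \<open>\<otimes>\<^sub>v\<close> 75) where
  "u \<otimes>\<^sub>v v = (\<lambda>(i, j). u i * v j)"

definition tensor_op :: "'i oper \<Rightarrow> 'j oper \<Rightarrow> ('i \<times> 'j) oper"  (infixr \<open>\<otimes>\<^sub>o\<close> 75) where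
  "P \<otimes>\<^sub>o Q = (\<lambda>(i, k) (j, l). P i j * Q k l)"

text \<open>The rank-one operator \<open>v v\<^sup>*\<close>.\<close>

definition outer :: "'i vec \<Rightarrow> 'i oper" where
  "outer v = (\<lambda>i j. v i * cnj (v j))"

definition ident :: "'i oper" where
  "ident = (\<lambda>i j. if i = j then 1 else 0)"

text \<open>Over the complex numbers this condition forces \<open>P\<close> to be Hermitian.\<close>

definition psd :: "'i set \<Rightarrow> 'i oper \<Rightarrow> bool" where
  "psd S P \<longleftrightarrow> (\<forall>v :: 'i vec. (\<Sum>i\<in>S. \<Sum>j\<in>S. cnj (v i) * P i j * v j) \<in> \<real>\<^sub>\<ge>\<^sub>0)"

definition density :: "'i set \<Rightarrow> 'i oper \<Rightarrow> bool" where
  "density S \<rho> \<longleftrightarrow> psd S \<rho> \<and> (\<Sum>i\<in>S. \<rho> i i) = 1"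

definition povm :: "'i set \<Rightarrow> 'i oper list \<Rightarrow> bool" where
  "povm S Ms \<longleftrightarrow> (\<forall>M\<in>set Ms. psd S M) \<and>
     (\<forall>i\<in>S. \<forall>j\<in>S. (\<Sum>M\<leftarrow>Ms. M i j) = ident i j)"

text \<open>The real part of \<open>tr (P \<rho>)\<close>; the trace is real whenever \<open>P\<close> and \<open>\<rho>\<close> are Hermitian.\<close>

definition born :: "'i set \<Rightarrow> 'i oper \<Rightarrow> 'i oper \<Rightarrow> real" where
  "born S P \<rho> = Re (\<Sum>i\<in>S. \<Sum>j\<in>S. P i j * \<rho> j i)"

text \<open>
  Quantum operations from \<open>\<complex>\<^sup>S\<close> to \<open>\<complex>\<^sup>T\<close> in operator-sum form: the list of Kraus operators \<open>K\<close>
  satisfies \<open>\<Sum> K\<^sup>* K = I\<close>. \<open>apply_op S Ks \<rho>\<close> is \<open>\<Sum> (K \<otimes> I) \<rho> (K \<otimes> I)\<^sup>*\<close>, the operation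
  applied to the first of two registers.
\<close>

definition quantum_operation :: "'s set \<Rightarrow> 't set \<Rightarrow> ('t, 's) matr list \<Rightarrow> bool" where
  "quantum_operation S T Ks \<longleftrightarrow>
     (\<forall>i\<in>S. \<forall>j\<in>S. (\<Sum>K\<leftarrow>Ks. \<Sum>t\<in>T. cnj (K t i) * K t j) = ident i j)"

definition apply_op :: "'s set \<Rightarrow> ('t, 's) matr list \<Rightarrow> ('s \<times> 'z) oper \<Rightarrow> ('t \<times> 'z) oper" where
  "apply_op S Ks \<rho> = (\<lambda>(t, z) (t', z').
     (\<Sum>K\<leftarrow>Ks. \<Sum>s\<in>S. \<Sum>s'\<in>S. K t s * \<rho> (s, z) (s', z') * cnj (K t' s')))"

text \<open>Reordering of registers; \<open>f\<close> sends a label in the new order to the label in the old order.\<close>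

definition reorder :: "('j \<Rightarrow> 'i) \<Rightarrow> 'i oper \<Rightarrow> 'j oper" where
  "reorder f \<rho> = (\<lambda>i j. \<rho> (f i) (f j))"

section \<open>The protocol\<close>

text \<open>Addition on type \<^typ>\<open>bit\<close> is XOR.\<close>

definition bits :: "bit set" where
  "bits = {0, 1}"

text \<open>
  \<open>commit S p b\<close> is \<open>\<psi>\<^sub>a\<close> for \<open>p = \<alpha>\<close> and \<open>\<phi>\<^sub>b\<close> for \<open>p = \<beta>\<close>; \<open>commit_state S p\<close> is \<open>\<psi>\<close>, respectively \<open>\<phi>\<close>,
  with registers in the order \<open>A\<^sub>0, A\<^sub>0', A, A'\<close> (respectively \<open>B\<^sub>0, B\<^sub>0', B, B'\<close>).
\<close>

definition commit :: "'i set \<Rightarrow> (bit \<Rightarrow> 'i \<Rightarrow> real) \<Rightarrow> bit \<Rightarrow> ('i \<times> 'i) vec" where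
  "commit S p b = (\<lambda>k. \<Sum>x\<in>S. complex_of_real (sqrt (p b x)) * (basis x \<otimes>\<^sub>v basis x) k)"

definition commit_state :: "'i set \<Rightarrow> (bit \<Rightarrow> 'i \<Rightarrow> real) \<Rightarrow> (bit \<times> bit \<times> 'i \<times> 'i) vec" where
  "commit_state S p =
     (\<lambda>k. \<Sum>b\<in>bits. complex_of_real (1 / sqrt 2) * (basis b \<otimes>\<^sub>v basis b \<otimes>\<^sub>v commit S p b) k)"

text \<open>
  \<open>measurement S p\<close> is Alice's measurement for \<open>p = \<beta>\<close> (registers \<open>A\<^sub>0, B\<^sub>0', B, B'\<close>) and Bob's for
  \<open>p = \<alpha>\<close> (registers \<open>B\<^sub>0, A\<^sub>0', A, A'\<close>). The outcome \<^const>\<open>None\<close> stands for abort.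
\<close>

definition accept :: "'i set \<Rightarrow> (bit \<Rightarrow> 'i \<Rightarrow> real) \<Rightarrow> bit \<Rightarrow> (bit \<times> bit \<times> 'i \<times> 'i) oper" where
  "accept S p c = (\<lambda>k l. \<Sum>b\<in>bits.
     (outer (basis (b + c)) \<otimes>\<^sub>o outer (basis b) \<otimes>\<^sub>o outer (commit S p b)) k l)"

definition measurement ::
    "'i set \<Rightarrow> (bit \<Rightarrow> 'i \<Rightarrow> real) \<Rightarrow> bit option \<Rightarrow> (bit \<times> bit \<times> 'i \<times> 'i) oper" where
  "measurement S p r = (case r of
       Some c \<Rightarrow> accept S p c
     | None \<Rightarrow> (\<lambda>k l. ident k l - accept S p 0 k l - accept S p 1 k l))"

section \<open>Cheating strategies\<close>

text \<open>
  The cheater's workspace has labels \<open>{..<d}\<close>, and its dimension may change with each operation.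
  Since the initial state is an arbitrary density operator, no separate operation precedes the
  cheater's first message (Alice) or the receipt of the first message (Bob).
\<close>

subsection \<open>Cheating Alice\<close>

text \<open>
  \<open>\<sigma>\<close> is the state of the register \<open>A\<close> of the first message and of the workspace; \<open>Ks\<close> is the operation
  between the receipt of \<open>B\<close> and the sending of \<open>A\<^sub>0', A'\<close>; \<open>Ms\<close> is the final measurement, on the
  workspace and \<open>B\<^sub>0', B'\<close>.
\<close>

definition alice_strategy ::
    "'a set \<Rightarrow> 'b set \<Rightarrow> nat \<Rightarrow> ('a \<times> nat) oper \<Rightarrow> nat \<Rightarrow>
     (bit \<times> 'a \<times> nat, nat \<times> 'b) matr list \<Rightarrow> (nat \<times> bit \<times> 'b) oper list \<Rightarrow> bool" where
  "alice_strategy A B d \<sigma> d' Ks Ms \<longleftrightarrow>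
     density (A \<times> {..<d}) \<sigma> \<and>
     quantum_operation ({..<d} \<times> B) (bits \<times> A \<times> {..<d'}) Ks \<and>
     povm ({..<d'} \<times> bits \<times> B) Ms"

definition alice_final ::
    "'a set \<Rightarrow> 'b set \<Rightarrow> (bit \<Rightarrow> 'b \<Rightarrow> real) \<Rightarrow> nat \<Rightarrow> ('a \<times> nat) oper \<Rightarrow>
     (bit \<times> 'a \<times> nat, nat \<times> 'b) matr list \<Rightarrow>
     ((nat \<times> bit \<times> 'b) \<times> (bit \<times> bit \<times> 'a \<times> 'a)) oper" where
  "alice_final A B \<beta> d \<sigma> Ks =
    (let
       \<comment> \<open>initial state, \<open>\<phi>\<close> on Bob's side\<close>
       \<rho>0 = \<sigma> \<otimes>\<^sub>o outer (commit_state B \<beta>);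
       \<comment> \<open>\<open>A\<close> goes to Bob and \<open>B\<close> goes to Alice\<close>
       \<rho>1 = reorder (\<lambda>((w, y), (x, b, b', y')). ((x, w), (b, b', y, y'))) \<rho>0;
       \<rho>2 = apply_op ({..<d} \<times> B) Ks \<rho>1
       \<comment> \<open>\<open>A\<^sub>0', A'\<close> go to Bob and \<open>B\<^sub>0', B'\<close> go to Alice\<close>
     in reorder (\<lambda>((w, b', y'), (b, a', x, x')). ((a', x', w), (x, b, b', y'))) \<rho>2)"

text \<open>The probability that Bob's outcome is \<open>r\<close>, summed over the outcomes of Alice's measurement.\<close>

definition alice_prob ::
    "'a set \<Rightarrow> 'b set \<Rightarrow> (bit \<Rightarrow> 'a \<Rightarrow> real) \<Rightarrow> (bit \<Rightarrow> 'b \<Rightarrow> real) \<Rightarrow> nat \<Rightarrow> ('a \<times> nat) oper \<Rightarrow> nat \<Rightarrow>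
     (bit \<times> 'a \<times> nat, nat \<times> 'b) matr list \<Rightarrow> (nat \<times> bit \<times> 'b) oper list \<Rightarrow> bit option \<Rightarrow> real" where
  "alice_prob A B \<alpha> \<beta> d \<sigma> d' Ks Ms r =
     (\<Sum>M\<leftarrow>Ms. born (({..<d'} \<times> bits \<times> B) \<times> (bits \<times> bits \<times> A \<times> A))
        (M \<otimes>\<^sub>o measurement A \<alpha> r) (alice_final A B \<beta> d \<sigma> Ks))"

definition P_A_star ::
    "'a set \<Rightarrow> 'b set \<Rightarrow> (bit \<Rightarrow> 'a \<Rightarrow> real) \<Rightarrow> (bit \<Rightarrow> 'b \<Rightarrow> real) \<Rightarrow> bit \<Rightarrow> real" where
  "P_A_star A B \<alpha> \<beta> c =
     Sup {alice_prob A B \<alpha> \<beta> d \<sigma> d' Ks Ms (Some c) | d \<sigma> d' Ks Ms. alice_strategy A B d \<sigma> d' Ks Ms}"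

subsection \<open>Cheating Bob\<close>

text \<open>
  \<open>\<sigma>\<close> is the state of the workspace; \<open>Ks\<close> is the operation between the receipt of \<open>A\<close> and the sending
  of \<open>B\<close>; \<open>Ls\<close> is the operation between the receipt of \<open>A\<^sub>0', A'\<close> and the sending of \<open>B\<^sub>0', B'\<close>; \<open>Ms\<close> is the
  final measurement, on the workspace.
\<close>

definition bob_strategy ::
    "'a set \<Rightarrow> 'b set \<Rightarrow> nat \<Rightarrow> nat oper \<Rightarrow> nat \<Rightarrow> ('b \<times> nat, nat \<times> 'a) matr list \<Rightarrow>
     nat \<Rightarrow> (bit \<times> 'b \<times> nat, nat \<times> bit \<times> 'a) matr list \<Rightarrow> nat oper list \<Rightarrow> bool" where
  "bob_strategy A B d \<sigma> d' Ks d'' Ls Ms \<longleftrightarrow>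
     density {..<d} \<sigma> \<and>
     quantum_operation ({..<d} \<times> A) (B \<times> {..<d'}) Ks \<and>
     quantum_operation ({..<d'} \<times> bits \<times> A) (bits \<times> B \<times> {..<d''}) Ls \<and>
     povm {..<d''} Ms"

definition bob_final ::
    "'a set \<Rightarrow> 'b set \<Rightarrow> (bit \<Rightarrow> 'a \<Rightarrow> real) \<Rightarrow> nat \<Rightarrow> nat oper \<Rightarrow> nat \<Rightarrow>
     ('b \<times> nat, nat \<times> 'a) matr list \<Rightarrow> (bit \<times> 'b \<times> nat, nat \<times> bit \<times> 'a) matr list \<Rightarrow>
     (nat \<times> (bit \<times> bit \<times> 'b \<times> 'b)) oper" where
  "bob_final A B \<alpha> d \<sigma> d' Ks Ls =
    (let
       \<comment> \<open>initial state, \<open>\<psi>\<close> on Alice's side\<close>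
       \<rho>0 = \<sigma> \<otimes>\<^sub>o outer (commit_state A \<alpha>);
       \<comment> \<open>\<open>A\<close> goes to Bob\<close>
       \<rho>1 = reorder (\<lambda>((w, x), (a, a', x')). (w, (a, a', x, x'))) \<rho>0;
       \<rho>2 = apply_op ({..<d} \<times> A) Ks \<rho>1;
       \<comment> \<open>\<open>B\<close> goes to Alice and \<open>A\<^sub>0', A'\<close> go to Bob\<close>
       \<rho>3 = reorder (\<lambda>((w, a', x'), (y, a)). ((y, w), (a, a', x'))) \<rho>2;
       \<rho>4 = apply_op ({..<d'} \<times> bits \<times> A) Ls \<rho>3
       \<comment> \<open>\<open>B\<^sub>0', B'\<close> go to Alice\<close>
     in reorder (\<lambda>(w, (a, b', y, y')). ((b', y', w), (y, a))) \<rho>4)"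

definition bob_prob ::
    "'a set \<Rightarrow> 'b set \<Rightarrow> (bit \<Rightarrow> 'a \<Rightarrow> real) \<Rightarrow> (bit \<Rightarrow> 'b \<Rightarrow> real) \<Rightarrow> nat \<Rightarrow> nat oper \<Rightarrow>
     nat \<Rightarrow> ('b \<times> nat, nat \<times> 'a) matr list \<Rightarrow> nat \<Rightarrow> (bit \<times> 'b \<times> nat, nat \<times> bit \<times> 'a) matr list \<Rightarrow>
     nat oper list \<Rightarrow> bit option \<Rightarrow> real" where
  "bob_prob A B \<alpha> \<beta> d \<sigma> d' Ks d'' Ls Ms r =
     (\<Sum>M\<leftarrow>Ms. born ({..<d''} \<times> (bits \<times> bits \<times> B \<times> B))
        (M \<otimes>\<^sub>o measurement B \<beta> r) (bob_final A B \<alpha> d \<sigma> d' Ks Ls))"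

definition P_B_star ::
    "'a set \<Rightarrow> 'b set \<Rightarrow> (bit \<Rightarrow> 'a \<Rightarrow> real) \<Rightarrow> (bit \<Rightarrow> 'b \<Rightarrow> real) \<Rightarrow> bit \<Rightarrow> real" where
  "P_B_star A B \<alpha> \<beta> c =
     Sup {bob_prob A B \<alpha> \<beta> d \<sigma> d' Ks d'' Ls Ms (Some c) | d \<sigma> d' Ks d'' Ls Ms.
            bob_strategy A B d \<sigma> d' Ks d'' Ls Ms}"

definition bias ::
    "'a set \<Rightarrow> 'b set \<Rightarrow> (bit \<Rightarrow> 'a \<Rightarrow> real) \<Rightarrow> (bit \<Rightarrow> 'b \<Rightarrow> real) \<Rightarrow> real" where
  "bias A B \<alpha> \<beta> =
     Max {P_A_star A B \<alpha> \<beta> 0, P_A_star A B \<alpha> \<beta> 1, P_B_star A B \<alpha> \<beta> 0, P_B_star A B \<alpha> \<beta> 1} - 1 / 2"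

end

theory Submission
  imports Defs
begin

text \<open>
  The bounds come from three explicit attacks, in which the cheater either ignores the first message
  it receives or measures it in the computational basis and acts on the classical value. Write \<open>f\<close> for the
  overlap \<open>\<Sum> \<surd>(p\<^sub>0 p\<^sub>1)\<close> of a pair of distributions and \<open>m\<close> for their common mass
  \<open>\<Sum> min p\<^sub>0 p\<^sub>1\<close>, so that \<open>1 - m\<close> is their total variation distance and \<open>1 - m / 2\<close> the
  probability of guessing from one sample, drawn with equal odds from \<open>p\<^sub>0\<close> or \<open>p\<^sub>1\<close>, which of the
  two it came from.

  \<^item> Bob may ignore the message of Alice and commit to the normalised sum of \<open>\<phi>\<^sub>0\<close> and \<open>\<phi>\<^sub>1\<close>, which
    he can open as either bit with probability \<open>(1 + f\<^sub>\<beta>) / 2\<close> (\<open>bob_lower_bound_ignoring\<close>).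
  \<^item> Bob may instead measure the message, guess \<open>a\<close> from it and commit honestly to the guess; he wins
    at least when the guess is right (\<open>bob_lower_bound_measuring\<close>).
  \<^item> Alice may commit to the normalised sum of \<open>\<psi>\<^sub>0\<close> and \<open>\<psi>\<^sub>1\<close>, guess \<open>b\<close> from the message of Bob and
    open her commitment as that bit (\<open>alice_lower_bound\<close>).

  If all three attacks had small success probability, then \<open>f\<^sub>\<beta>\<close> would be small, hence so would \<open>m\<^sub>\<beta>\<close>
  because \<open>m \<le> f\<close>; also \<open>m\<^sub>\<alpha>\<close> would be large, hence so would \<open>f\<^sub>\<alpha>\<close>. But then Alice both guesses \<open>b\<close>
  well and opens well, so her attack succeeds. On two points the estimate improves to \<open>m \<le> f\<^sup>2\<close>
  (\<open>common_mass_le_overlap_square\<close>), and the three constants of the theorem correspond to using this for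
  both parties, for \<open>\<beta>\<close> only and for \<open>\<alpha>\<close> only.

  The cheating probabilities are suprema of real numbers, and an attack bounds such a supremum from
  below only because the set of all success probabilities is bounded above. The first part of the
  development supplies this bound: the final states of arbitrary strategies are density operators,
  and the probability of an outcome is at most a constant that depends on the measurement of the
  honest party alone.
\<close>

section \<open>Positivity, trace and boundedness\<close>

lemma psd_cong:
  assumes "psd S P" and "\<And>i j. i \<in> S \<Longrightarrow> j \<in> S \<Longrightarrow> P i j = Q i j"
  shows "psd S Q"
  using assms unfolding psd_def by (simp cong: sum.cong)

text \<open>
  Tensoring with a pure state, relabelling registers and applying one Kraus operator all have the
  form \<open>\<rho> \<mapsto> G \<rho> G\<^sup>*\<close>, so this is the only positivity argument needed for the steps of the protocol.
\<close>

lemma psd_congruence: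
  fixes S :: "'i set" and T :: "'j set" and G :: "('j, 'i) matr"
  assumes "psd S \<rho>"
  shows "psd T (\<lambda>i j. \<Sum>s\<in>S. \<Sum>s'\<in>S. G i s * \<rho> s s' * cnj (G j s'))"
  unfolding psd_def
proof
  fix v :: "'j vec"
  define u where "u s = (\<Sum>i\<in>T. cnj (G i s) * v i)" for s
  have "(\<Sum>i\<in>T. \<Sum>j\<in>T. cnj (v i) * (\<Sum>s\<in>S. \<Sum>s'\<in>S. G i s * \<rho> s s' * cnj (G j s')) * v j)
      = (\<Sum>i\<in>T. \<Sum>j\<in>T. \<Sum>s\<in>S. \<Sum>s'\<in>S. (cnj (v i) * G i s) * \<rho> s s' * (cnj (G j s') * v j))"
    by (simp add: sum_distrib_left sum_distrib_right mult.assoc)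
  also have "\<dots> = (\<Sum>i\<in>T. \<Sum>s\<in>S. \<Sum>j\<in>T. \<Sum>s'\<in>S. (cnj (v i) * G i s) * \<rho> s s' * (cnj (G j s') * v j))"
    by (intro sum.cong refl sum.swap)
  also have "\<dots> = (\<Sum>i\<in>T. \<Sum>s\<in>S. \<Sum>s'\<in>S. \<Sum>j\<in>T. (cnj (v i) * G i s) * \<rho> s s' * (cnj (G j s') * v j))"
    by (intro sum.cong refl sum.swap)
  also have "\<dots> = (\<Sum>i\<in>T. \<Sum>s\<in>S. \<Sum>s'\<in>S. (cnj (v i) * G i s) * (\<rho> s s' * u s'))"
    by (simp add: u_def sum_distrib_left mult.assoc)
  also have "\<dots> = (\<Sum>s\<in>S. \<Sum>i\<in>T. \<Sum>s'\<in>S. (cnj (v i) * G i s) * (\<rho> s s' * u s'))"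
    by (rule sum.swap)
  also have "\<dots> = (\<Sum>s\<in>S. \<Sum>s'\<in>S. \<Sum>i\<in>T. (cnj (v i) * G i s) * (\<rho> s s' * u s'))"
    by (intro sum.cong refl sum.swap)
  also have "\<dots> = (\<Sum>s\<in>S. \<Sum>s'\<in>S. cnj (u s) * \<rho> s s' * u s')"
  proof -
    have "cnj (u s) = (\<Sum>i\<in>T. cnj (v i) * G i s)" for s
      by (simp add: u_def mult.commute)
    then show ?thesis by (simp add: sum_distrib_right mult.assoc)
  qed
  also have "\<dots> \<in> \<real>\<^sub>\<ge>\<^sub>0"
    using assms unfolding psd_def by blast
  finally show "(\<Sum>i\<in>T. \<Sum>j\<in>T. cnj (v i) *
      (\<Sum>s\<in>S. \<Sum>s'\<in>S. G i s * \<rho> s s' * cnj (G j s')) * v j) \<in> \<real>\<^sub>\<ge>\<^sub>0" .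
qed

lemma psd_add:
  assumes "psd S P" "psd S Q"
  shows "psd S (\<lambda>i j. P i j + Q i j)"
proof -
  have "(\<Sum>i\<in>S. \<Sum>j\<in>S. cnj (v i) * (P i j + Q i j) * v j) =
      (\<Sum>i\<in>S. \<Sum>j\<in>S. cnj (v i) * P i j * v j) + (\<Sum>i\<in>S. \<Sum>j\<in>S. cnj (v i) * Q i j * v j)" for v
    by (simp add: sum.distrib algebra_simps)
  then show ?thesis
    using assms unfolding psd_def by (auto intro: nonneg_Reals_add_I)
qed

lemma psd_ident:
  fixes S :: "'i set"
  assumes "finite S"
  shows "psd S ident"
proof -
  have "(\<Sum>i\<in>S. \<Sum>j\<in>S. cnj (v i) * ident i j * v j) = complex_of_real (\<Sum>i\<in>S. (cmod (v i))\<^sup>2)"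
    for v :: "'i vec"
  proof -
    have "(\<Sum>j\<in>S. cnj (v i) * ident i j * v j) = cnj (v i) * v i" if "i \<in> S" for i
    proof -
      have "(\<Sum>j\<in>S. cnj (v i) * ident i j * v j) = (\<Sum>j\<in>S. if i = j then cnj (v i) * v j else 0)"
        by (intro sum.cong) (auto simp: ident_def)
      then show ?thesis using that assms by simp
    qed
    then show ?thesis
      by (simp add: complex_norm_square[symmetric] mult.commute[of "cnj _"] del: of_real_power)
  qed
  then show ?thesis
    unfolding psd_def by (simp only:) (simp add: sum_nonneg del: of_real_sum of_real_power)
qed

text \<open>
  The off-diagonal bound is positivity tested on the vector with entry \<open>1\<close> at \<open>i\<close> and entry \<open>z\<close> at
  \<open>j\<close>: the values \<open>z = 1\<close> and \<open>z = \<i>\<close> show that the matrix is Hermitian, and then the phase \<open>z\<close> that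
  makes the cross terms as negative as possible gives the inequality.
\<close>

lemma psd_entry:
  fixes S :: "'i set"
  assumes fin: "finite S" and psd: "psd S \<rho>" and i: "i \<in> S" and j: "j \<in> S"
  shows "Im (\<rho> i i) = 0" "Re (\<rho> i i) \<ge> 0" "cmod (\<rho> j i) \<le> (Re (\<rho> i i) + Re (\<rho> j j)) / 2"
proof -
  have diag: "\<rho> k k \<in> \<real>\<^sub>\<ge>\<^sub>0" if k: "k \<in> S" for k
  proof -
    define v :: "'i vec" where "v = (\<lambda>l. if l = k then 1 else 0)"
    have "(\<Sum>a\<in>S. \<Sum>b\<in>S. cnj (v a) * \<rho> a b * v b) = (\<Sum>a\<in>{k}. \<Sum>b\<in>{k}. cnj (v a) * \<rho> a b * v b)"
    proof -
      have "(\<Sum>b\<in>S. cnj (v a) * \<rho> a b * v b) = (\<Sum>b\<in>{k}. cnj (v a) * \<rho> a b * v b)" for a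
        using k fin by (intro sum.mono_neutral_right) (auto simp: v_def)
      then show ?thesis
        using k fin by (simp only:) (intro sum.mono_neutral_right, auto simp: v_def)
    qed
    also have "\<dots> = \<rho> k k" by (simp add: v_def)
    finally show ?thesis using psd[unfolded psd_def, rule_format, of v] by (simp only:)
  qed
  show im: "Im (\<rho> i i) = 0" and re: "Re (\<rho> i i) \<ge> 0"
    using diag[OF i] by (auto simp: complex_nonneg_Reals_iff)
  show "cmod (\<rho> j i) \<le> (Re (\<rho> i i) + Re (\<rho> j j)) / 2"
  proof (cases "i = j")
    case True
    then show ?thesis using im re by (simp add: cmod_def)
  next
    case False
    have form: "\<rho> i i + z * \<rho> i j + cnj z * \<rho> j i + cnj z * z * \<rho> j j \<in> \<real>\<^sub>\<ge>\<^sub>0" for z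
    proof -
      define v :: "'i vec" where "v = (\<lambda>l. if l = i then 1 else if l = j then z else 0)"
      have "(\<Sum>a\<in>S. \<Sum>b\<in>S. cnj (v a) * \<rho> a b * v b) = (\<Sum>a\<in>{i,j}. \<Sum>b\<in>{i,j}. cnj (v a) * \<rho> a b * v b)"
      proof -
        have "(\<Sum>b\<in>S. cnj (v a) * \<rho> a b * v b) = (\<Sum>b\<in>{i,j}. cnj (v a) * \<rho> a b * v b)" for a
          using i j fin by (intro sum.mono_neutral_right) (auto simp: v_def)
        then show ?thesis
          using i j fin by (simp only:) (intro sum.mono_neutral_right, auto simp: v_def)
      qed
      also have "\<dots> = \<rho> i i + z * \<rho> i j + cnj z * \<rho> j i + cnj z * z * \<rho> j j"
        using False by (simp add: v_def algebra_simps)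
      finally show ?thesis using psd[unfolded psd_def, rule_format, of v] by (simp only:)
    qed
    have imj: "Im (\<rho> j j) = 0"
      using diag[OF j] by (auto simp: complex_nonneg_Reals_iff)
    have h1: "Im (\<rho> i j) = - Im (\<rho> j i)"
      using form[of 1] im imj by (simp add: complex_nonneg_Reals_iff)
    have h2: "Re (\<rho> i j) = Re (\<rho> j i)"
      using form[of \<i>] im imj by (simp add: complex_nonneg_Reals_iff)
    have herm: "\<rho> i j = cnj (\<rho> j i)"
      using h1 h2 by (simp add: complex_eq_iff)
    show ?thesis
    proof (cases "\<rho> j i = 0")
      case True
      then show ?thesis using re diag[OF j] by (simp add: complex_nonneg_Reals_iff)
    next
      case nz: False
      define z where "z = - sgn (\<rho> j i)"
      have unit: "cnj (sgn (\<rho> j i)) * sgn (\<rho> j i) = 1"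
        using nz by (metis complex_norm_square mult.commute norm_sgn of_real_1 power_one)
      then have zz: "cnj z * z = 1"
        by (simp add: z_def)
      have "\<rho> j i = sgn (\<rho> j i) * complex_of_real (cmod (\<rho> j i))"
        using nz by (simp add: sgn_eq)
      then have "cnj z * \<rho> j i = - (cnj (sgn (\<rho> j i)) * sgn (\<rho> j i)) * complex_of_real (cmod (\<rho> j i))"
        unfolding z_def by (metis complex_cnj_minus minus_mult_left mult.assoc)
      then have "cnj z * \<rho> j i = - complex_of_real (cmod (\<rho> j i))"
        using unit by simp
      moreover from this have "z * \<rho> i j = - complex_of_real (cmod (\<rho> j i))"
        unfolding herm by (metis complex_cnj_cnj complex_cnj_complex_of_real complex_cnj_minus complex_cnj_mult)
      ultimately have "\<rho> i i + \<rho> j j - 2 * complex_of_real (cmod (\<rho> j i)) \<in> \<real>\<^sub>\<ge>\<^sub>0"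
        using form[of z, unfolded zz] by (simp add: algebra_simps)
      then show ?thesis by (simp add: complex_nonneg_Reals_iff)
    qed
  qed
qed

text \<open>
  A Schur test: the modulus of each entry of \<open>\<rho>\<close> is at most the mean of two diagonal entries, and the
  diagonal sums to \<open>1\<close>. The bound is crude, but only its independence of the workspace matters.
\<close>

lemma born_le_row_bound:
  assumes fin: "finite S" and dens: "density S \<rho>"
    and rows: "\<And>i. i \<in> S \<Longrightarrow> (\<Sum>j\<in>S. cmod (Q i j)) \<le> C"
    and cols: "\<And>j. j \<in> S \<Longrightarrow> (\<Sum>i\<in>S. cmod (Q i j)) \<le> C"
  shows "born S Q \<rho> \<le> C"
proof -
  have psd: "psd S \<rho>" and tr: "(\<Sum>i\<in>S. \<rho> i i) = 1"
    using dens by (auto simp: density_def)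
  have tr': "(\<Sum>i\<in>S. Re (\<rho> i i)) = 1"
    using arg_cong[OF tr, of Re] by simp
  have "born S Q \<rho> \<le> cmod (\<Sum>i\<in>S. \<Sum>j\<in>S. Q i j * \<rho> j i)"
    unfolding born_def by (rule complex_Re_le_cmod)
  also have "\<dots> \<le> (\<Sum>i\<in>S. \<Sum>j\<in>S. cmod (Q i j * \<rho> j i))"
    by (rule order_trans[OF norm_sum sum_mono[OF norm_sum]])
  also have "\<dots> \<le> (\<Sum>i\<in>S. \<Sum>j\<in>S. cmod (Q i j) * ((Re (\<rho> i i) + Re (\<rho> j j)) / 2))"
    unfolding norm_mult using psd_entry(3)[OF fin psd]
    by (intro sum_mono mult_left_mono) auto
  also have "\<dots> = (\<Sum>i\<in>S. \<Sum>j\<in>S. cmod (Q i j) * Re (\<rho> i i)) / 2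
      + (\<Sum>i\<in>S. \<Sum>j\<in>S. cmod (Q i j) * Re (\<rho> j j)) / 2"
    by (simp add: sum.distrib distrib_left add_divide_distrib sum_divide_distrib)
  also have "(\<Sum>i\<in>S. \<Sum>j\<in>S. cmod (Q i j) * Re (\<rho> j j)) = (\<Sum>j\<in>S. \<Sum>i\<in>S. cmod (Q i j) * Re (\<rho> j j))"
    by (rule sum.swap)
  also have "(\<Sum>i\<in>S. \<Sum>j\<in>S. cmod (Q i j) * Re (\<rho> i i)) \<le> (\<Sum>i\<in>S. C * Re (\<rho> i i))"
    unfolding sum_distrib_right[symmetric] using rows psd_entry(2)[OF fin psd]
    by (intro sum_mono mult_right_mono) auto
  also have "(\<Sum>j\<in>S. \<Sum>i\<in>S. cmod (Q i j) * Re (\<rho> j j)) \<le> (\<Sum>j\<in>S. C * Re (\<rho> j j))"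
    unfolding sum_distrib_right[symmetric] using cols psd_entry(2)[OF fin psd]
    by (intro sum_mono mult_right_mono) auto
  finally show ?thesis by (simp add: tr' flip: sum_distrib_left)
qed

lemma sum_sum_list_swap: "(\<Sum>x\<in>S. \<Sum>K\<leftarrow>Ks. f x K) = (\<Sum>K\<leftarrow>Ks. \<Sum>x\<in>S. f x K :: 'c :: comm_monoid_add)"
  by (induction Ks) (simp_all add: sum.distrib)

lemma density_reorder:
  assumes bij: "bij_betw f T S" and fin: "finite S" and dens: "density S \<rho>"
  shows "density T (reorder f \<rho>)"
proof -
  have mem: "f i \<in> S" if "i \<in> T" for i
    using bij that by (auto dest: bij_betwE)
  have "psd T (\<lambda>i j. \<Sum>s\<in>S. \<Sum>s'\<in>S. (if s = f i then 1 else 0) * \<rho> s s' * cnj (if s' = f j then 1 else 0))"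
    using dens by (intro psd_congruence) (simp add: density_def)
  moreover have "(\<Sum>s\<in>S. \<Sum>s'\<in>S. (if s = f i then 1 else 0) * \<rho> s s' * cnj (if s' = f j then 1 else 0))
      = reorder f \<rho> i j" if "i \<in> T" "j \<in> T" for i j
  proof -
    have "(\<Sum>s\<in>S. \<Sum>s'\<in>S. (if s = f i then 1 else 0) * \<rho> s s' * cnj (if s' = f j then 1 else 0))
        = (\<Sum>s\<in>S. if s = f i then (\<Sum>s'\<in>S. if s' = f j then \<rho> s s' else 0) else 0)"
      by (intro sum.cong) (auto intro!: sum.cong)
    then show ?thesis using that fin mem by (simp add: reorder_def)
  qed
  ultimately have "psd T (reorder f \<rho>)"
    by (rule psd_cong)
  moreover have "(\<Sum>i\<in>T. reorder f \<rho> i i) = (\<Sum>i\<in>S. \<rho> i i)"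
    unfolding reorder_def by (rule sum.reindex_bij_betw[OF bij, of "\<lambda>i. \<rho> i i"])
  ultimately show ?thesis using dens by (simp add: density_def)
qed

lemma density_tensor_outer:
  fixes S :: "'i set" and T :: "'j set"
  assumes fin: "finite S" and dens: "density S \<rho>" and unit: "(\<Sum>t\<in>T. \<phi> t * cnj (\<phi> t)) = 1"
  shows "density (S \<times> T) (\<rho> \<otimes>\<^sub>o outer \<phi>)"
proof -
  define G :: "('i \<times> 'j, 'i) matr" where "G = (\<lambda>(i, t) s. if s = i then \<phi> t else 0)"
  have "psd (S \<times> T) (\<lambda>i j. \<Sum>s\<in>S. \<Sum>s'\<in>S. G i s * \<rho> s s' * cnj (G j s'))"
    using dens by (intro psd_congruence) (simp add: density_def)
  moreover have "(\<Sum>s\<in>S. \<Sum>s'\<in>S. G i s * \<rho> s s' * cnj (G j s')) = (\<rho> \<otimes>\<^sub>o outer \<phi>) i j"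
    if ij: "i \<in> S \<times> T" "j \<in> S \<times> T" for i j
  proof -
    obtain a t where i: "i = (a, t)" by (cases i)
    obtain b u where j: "j = (b, u)" by (cases j)
    have "(\<Sum>s\<in>S. \<Sum>s'\<in>S. G i s * \<rho> s s' * cnj (G j s'))
        = (\<Sum>s\<in>S. if s = a then (\<Sum>s'\<in>S. if s' = b then \<phi> t * \<rho> s s' * cnj (\<phi> u) else 0) else 0)"
      by (intro sum.cong) (auto simp: G_def i j intro!: sum.cong)
    then show ?thesis using ij fin by (simp add: i j tensor_op_def outer_def)
  qed
  ultimately have "psd (S \<times> T) (\<rho> \<otimes>\<^sub>o outer \<phi>)"
    by (rule psd_cong)
  moreover have "(\<Sum>i\<in>S \<times> T. (\<rho> \<otimes>\<^sub>o outer \<phi>) i i) = (\<Sum>i\<in>S. \<rho> i i) * (\<Sum>t\<in>T. \<phi> t * cnj (\<phi> t))"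
    unfolding sum_product by (simp add: sum.cartesian_product tensor_op_def outer_def case_prod_beta)
  ultimately show ?thesis using dens unit by (simp add: density_def)
qed

lemma psd_apply_op:
  fixes S :: "'s set" and T :: "'t set" and Z :: "'z set"
  assumes fin: "finite S" "finite Z" and psd: "psd (S \<times> Z) \<rho>"
  shows "psd (T \<times> Z) (apply_op S Ks \<rho>)"
proof (induction Ks)
  case Nil
  then show ?case by (simp add: psd_def apply_op_def)
next
  case (Cons K Ks)
  define G :: "('t \<times> 'z, 's \<times> 'z) matr" where "G = (\<lambda>(t, z) (s, z'). if z' = z then K t s else 0)"
  have "psd (T \<times> Z) (\<lambda>i j. (\<Sum>s\<in>S\<times>Z. \<Sum>s'\<in>S\<times>Z. G i s * \<rho> s s' * cnj (G j s')) + apply_op S Ks \<rho> i j)"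
    using psd Cons.IH by (intro psd_add psd_congruence)
  moreover have "(\<Sum>s\<in>S\<times>Z. \<Sum>s'\<in>S\<times>Z. G i s * \<rho> s s' * cnj (G j s')) + apply_op S Ks \<rho> i j
      = apply_op S (K # Ks) \<rho> i j" if ij: "i \<in> T \<times> Z" "j \<in> T \<times> Z" for i j
  proof -
    obtain t z where i: "i = (t, z)" by (cases i)
    obtain t' z' where j: "j = (t', z')" by (cases j)
    have "(\<Sum>s\<in>S\<times>Z. \<Sum>s'\<in>S\<times>Z. G i s * \<rho> s s' * cnj (G j s'))
        = (\<Sum>s\<in>S. \<Sum>y\<in>Z. \<Sum>s'\<in>S. \<Sum>y'\<in>Z. G i (s, y) * \<rho> (s, y) (s', y') * cnj (G j (s', y')))"
      by (simp add: sum.cartesian_product')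
    also have "\<dots> = (\<Sum>s\<in>S. \<Sum>y\<in>Z. if y = z then \<Sum>s'\<in>S. \<Sum>y'\<in>Z. if y' = z' then
        K t s * \<rho> (s, y) (s', y') * cnj (K t' s') else 0 else 0)"
      by (intro sum.cong) (auto simp: G_def i j intro!: sum.cong sum.neutral)
    also have "\<dots> = (\<Sum>s\<in>S. \<Sum>s'\<in>S. K t s * \<rho> (s, z) (s', z') * cnj (K t' s'))"
      using ij fin by (simp add: i j)
    finally show ?thesis by (simp add: apply_op_def i j)
  qed
  ultimately show ?case
    by (rule psd_cong)
qed

lemma density_apply_op:
  fixes S :: "'s set" and T :: "'t set" and Z :: "'z set"
  assumes fin: "finite S" "finite Z" and op: "quantum_operation S T Ks" and dens: "density (S \<times> Z) \<rho>"
  shows "density (T \<times> Z) (apply_op S Ks \<rho>)"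
proof -
  have "(\<Sum>i\<in>T \<times> Z. apply_op S Ks \<rho> i i)
      = (\<Sum>t\<in>T. \<Sum>z\<in>Z. \<Sum>K\<leftarrow>Ks. \<Sum>s\<in>S. \<Sum>s'\<in>S. K t s * \<rho> (s, z) (s', z) * cnj (K t s'))"
    by (simp add: sum.cartesian_product' apply_op_def)
  also have "\<dots> = (\<Sum>z\<in>Z. \<Sum>t\<in>T. \<Sum>K\<leftarrow>Ks. \<Sum>s\<in>S. \<Sum>s'\<in>S. K t s * \<rho> (s, z) (s', z) * cnj (K t s'))"
    by (rule sum.swap)
  also have "\<dots> = (\<Sum>z\<in>Z. \<Sum>s\<in>S. \<Sum>s'\<in>S. \<rho> (s, z) (s', z) * ident s' s)"
  proof (rule sum.cong[OF refl])
    fix z assume "z \<in> Z"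
    have "(\<Sum>t\<in>T. \<Sum>K\<leftarrow>Ks. \<Sum>s\<in>S. \<Sum>s'\<in>S. K t s * \<rho> (s, z) (s', z) * cnj (K t s'))
        = (\<Sum>K\<leftarrow>Ks. \<Sum>t\<in>T. \<Sum>s\<in>S. \<Sum>s'\<in>S. K t s * \<rho> (s, z) (s', z) * cnj (K t s'))"
      by (rule sum_sum_list_swap)
    also have "\<dots> = (\<Sum>K\<leftarrow>Ks. \<Sum>s\<in>S. \<Sum>s'\<in>S. \<Sum>t\<in>T. K t s * \<rho> (s, z) (s', z) * cnj (K t s'))"
    proof -
      have "(\<Sum>t\<in>T. \<Sum>s\<in>S. \<Sum>s'\<in>S. f t s s') = (\<Sum>s\<in>S. \<Sum>s'\<in>S. \<Sum>t\<in>T. f t s s')"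
        for f :: "'t \<Rightarrow> 's \<Rightarrow> 's \<Rightarrow> complex"
        by (subst sum.swap) (intro sum.cong refl sum.swap)
      then show ?thesis by simp
    qed
    also have "\<dots> = (\<Sum>s\<in>S. \<Sum>s'\<in>S. \<Sum>K\<leftarrow>Ks. \<rho> (s, z) (s', z) * (\<Sum>t\<in>T. cnj (K t s') * K t s))"
      by (simp add: sum_sum_list_swap sum_distrib_left mult_ac)
    also have "\<dots> = (\<Sum>s\<in>S. \<Sum>s'\<in>S. \<rho> (s, z) (s', z) * ident s' s)"
      using op by (intro sum.cong refl) (simp add: sum_list_const_mult quantum_operation_def)
    finally show "(\<Sum>t\<in>T. \<Sum>K\<leftarrow>Ks. \<Sum>s\<in>S. \<Sum>s'\<in>S. K t s * \<rho> (s, z) (s', z) * cnj (K t s'))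
        = (\<Sum>s\<in>S. \<Sum>s'\<in>S. \<rho> (s, z) (s', z) * ident s' s)" .
  qed
  also have "\<dots> = (\<Sum>z\<in>Z. \<Sum>s\<in>S. \<rho> (s, z) (s, z))"
  proof (intro sum.cong refl)
    fix z s assume "s \<in> S"
    have "(\<Sum>s'\<in>S. \<rho> (s, z) (s', z) * ident s' s) = (\<Sum>s'\<in>S. if s' = s then \<rho> (s, z) (s', z) else 0)"
      by (intro sum.cong) (auto simp: ident_def)
    then show "(\<Sum>s'\<in>S. \<rho> (s, z) (s', z) * ident s' s) = \<rho> (s, z) (s, z)"
      using \<open>s \<in> S\<close> fin by simp
  qed
  also have "\<dots> = (\<Sum>i\<in>S \<times> Z. \<rho> i i)"
    unfolding sum.cartesian_product' by (rule sum.swap)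
  finally show ?thesis
    using dens psd_apply_op[OF fin, of \<rho> T Ks] by (simp add: density_def)
qed

text \<open>
  The outcome of the cheater's own final measurement is summed over, so that measurement may be
  replaced by the identity.
\<close>

lemma sum_list_born_povm:
  assumes "povm R Ms"
  shows "(\<Sum>M\<leftarrow>Ms. born (R \<times> K) (M \<otimes>\<^sub>o P) \<rho>) = born (R \<times> K) (ident \<otimes>\<^sub>o P) \<rho>"
proof -
  have entry: "(\<Sum>M\<leftarrow>Ms. (M \<otimes>\<^sub>o P) i j * \<rho> j i) = (ident \<otimes>\<^sub>o P) i j * \<rho> j i"
    if "i \<in> R \<times> K" "j \<in> R \<times> K" for i j
    using assms that
    by (cases i; cases j) (simp add: tensor_op_def povm_def sum_list_mult_const)
  have "(\<Sum>M\<leftarrow>Ms. born (R \<times> K) (M \<otimes>\<^sub>o P) \<rho>)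
      = Re (\<Sum>M\<leftarrow>Ms. \<Sum>i\<in>R \<times> K. \<Sum>j\<in>R \<times> K. (M \<otimes>\<^sub>o P) i j * \<rho> j i)"
    unfolding born_def by (induction Ms) auto
  also have "\<dots> = born (R \<times> K) (ident \<otimes>\<^sub>o P) \<rho>"
    unfolding born_def using entry by (simp add: sum_sum_list_swap[symmetric] cong: sum.cong)
  finally show ?thesis .
qed

text \<open>
  The bound does not mention \<open>R\<close>, the register of the cheater: the absolute row sums of
  \<open>ident \<otimes>\<^sub>o P\<close> are those of \<open>P\<close>, whatever the dimension of the workspace.
\<close>

lemma povm_outcome_bound:
  assumes fin: "finite R" "finite K" and povm: "povm R Ms" and dens: "density (R \<times> K) \<rho>"
  shows "(\<Sum>M\<leftarrow>Ms. born (R \<times> K) (M \<otimes>\<^sub>o P) \<rho>) \<le> (\<Sum>k\<in>K. \<Sum>l\<in>K. cmod (P k l))"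
  unfolding sum_list_born_povm[OF povm]
proof (rule born_le_row_bound[OF _ dens])
  show "finite (R \<times> K)" using fin by simp
next
  fix i assume "i \<in> R \<times> K"
  then obtain r k where i: "i = (r, k)" and r: "r \<in> R" and k: "k \<in> K" by blast
  have "(\<Sum>j\<in>R \<times> K. cmod ((ident \<otimes>\<^sub>o P) i j)) = (\<Sum>r'\<in>R. if r = r' then \<Sum>l\<in>K. cmod (P k l) else 0)"
    unfolding sum.cartesian_product' by (intro sum.cong) (auto simp: i tensor_op_def ident_def)
  also have "\<dots> = (\<Sum>l\<in>K. cmod (P k l))" using r fin by simp
  also have "\<dots> \<le> (\<Sum>k\<in>K. \<Sum>l\<in>K. cmod (P k l))"
    using k fin by (intro member_le_sum[of k K "\<lambda>k. \<Sum>l\<in>K. cmod (P k l)"]) (auto intro: sum_nonneg)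
  finally show "(\<Sum>j\<in>R \<times> K. cmod ((ident \<otimes>\<^sub>o P) i j)) \<le> (\<Sum>k\<in>K. \<Sum>l\<in>K. cmod (P k l))" .
next
  fix i assume "i \<in> R \<times> K"
  then obtain r l where i: "i = (r, l)" and r: "r \<in> R" and l: "l \<in> K" by blast
  have "(\<Sum>j\<in>R \<times> K. cmod ((ident \<otimes>\<^sub>o P) j i)) = (\<Sum>r'\<in>R. if r' = r then \<Sum>k\<in>K. cmod (P k l) else 0)"
    unfolding sum.cartesian_product' by (intro sum.cong) (auto simp: i tensor_op_def ident_def)
  also have "\<dots> = (\<Sum>k\<in>K. cmod (P k l))" using r fin by simp
  also have "\<dots> \<le> (\<Sum>k\<in>K. \<Sum>l\<in>K. cmod (P k l))"
    using l fin by (intro sum_mono member_le_sum) auto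
  finally show "(\<Sum>j\<in>R \<times> K. cmod ((ident \<otimes>\<^sub>o P) j i)) \<le> (\<Sum>k\<in>K. \<Sum>l\<in>K. cmod (P k l))" .
qed

section \<open>Mixtures of pure states\<close>

text \<open>
  Starting from a pure state, a strategy leads to one unnormalised pure state per choice of Kraus
  operators. Carrying the list of these vectors through the protocol replaces computations with
  matrices by computations with vectors.
\<close>

definition mixture :: "'i vec list \<Rightarrow> 'i oper" where
  "mixture Ws = (\<lambda>i j. \<Sum>W\<leftarrow>Ws. outer W i j)"

definition kraus_vec :: "'s set \<Rightarrow> ('t, 's) matr \<Rightarrow> ('s \<times> 'z) vec \<Rightarrow> ('t \<times> 'z) vec" where
  "kraus_vec S K W = (\<lambda>(t, z). \<Sum>s\<in>S. K t s * W (s, z))"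

lemma outer_tensor: "outer u \<otimes>\<^sub>o outer v = outer (u \<otimes>\<^sub>v v)"
  by (auto simp: outer_def tensor_op_def tensor_vec_def fun_eq_iff)

lemma outer_mixture: "outer W = mixture [W]"
  by (simp add: mixture_def)

lemma reorder_mixture: "reorder f (mixture Ws) = mixture (map (\<lambda>W. W \<circ> f) Ws)"
  by (simp add: reorder_def mixture_def outer_def comp_def)

lemma apply_op_mixture:
  fixes Ws :: "('s \<times> 'z) vec list" and Ks :: "('t, 's) matr list"
  shows "apply_op S Ks (mixture Ws) = mixture (concat (map (\<lambda>K. map (kraus_vec S K) Ws) Ks))"
proof (intro ext)
  fix i j :: "'t \<times> 'z"
  obtain t z where i: "i = (t, z)" by (cases i)
  obtain t' z' where j: "j = (t', z')" by (cases j)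
  have one: "(\<Sum>s\<in>S. \<Sum>s'\<in>S. K t s * mixture Ws (s, z) (s', z') * cnj (K t' s'))
      = (\<Sum>W\<leftarrow>map (kraus_vec S K) Ws. outer W i j)" for K :: "('t, 's) matr"
  proof (induction Ws)
    case Nil
    then show ?case by (simp add: mixture_def)
  next
    case (Cons W Ws)
    have "outer (kraus_vec S K W) i j = (\<Sum>s\<in>S. \<Sum>s'\<in>S. K t s * outer W (s, z) (s', z') * cnj (K t' s'))"
      by (simp add: outer_def kraus_vec_def i j sum_product mult_ac)
    then show ?case
      using Cons.IH by (simp add: mixture_def sum.distrib distrib_left distrib_right)
  qed
  show "apply_op S Ks (mixture Ws) i j = mixture (concat (map (\<lambda>K. map (kraus_vec S K) Ws) Ks)) i j"
    unfolding apply_op_def i j case_prod_conv one[unfolded i j]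
    by (induction Ks) (simp_all add: mixture_def)
qed

lemma born_mixture: "born S Q (mixture Ws) = (\<Sum>W\<leftarrow>Ws. born S Q (outer W))"
  by (induction Ws) (simp_all add: born_def mixture_def distrib_left sum.distrib)

lemma born_ident_outer:
  assumes "finite R"
  shows "born (R \<times> K) (ident \<otimes>\<^sub>o outer u) (outer W) = (\<Sum>r\<in>R. (cmod (\<Sum>k\<in>K. cnj (u k) * W (r, k)))\<^sup>2)"
proof -
  have "(\<Sum>i\<in>R \<times> K. \<Sum>j\<in>R \<times> K. (ident \<otimes>\<^sub>o outer u) i j * outer W j i)
      = (\<Sum>r\<in>R. \<Sum>k\<in>K. \<Sum>r'\<in>R. if r = r' then
            \<Sum>l\<in>K. u k * cnj (u l) * (W (r', l) * cnj (W (r, k))) else 0)"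
    unfolding sum.cartesian_product'
    by (intro sum.cong refl) (auto simp: tensor_op_def ident_def outer_def)
  also have "\<dots> = (\<Sum>r\<in>R. \<Sum>k\<in>K. \<Sum>l\<in>K. u k * cnj (u l) * (W (r, l) * cnj (W (r, k))))"
    using assms by simp
  also have "\<dots> = (\<Sum>r\<in>R. (\<Sum>k\<in>K. cnj (u k) * W (r, k)) * cnj (\<Sum>k\<in>K. cnj (u k) * W (r, k)))"
  proof (intro sum.cong refl)
    fix r
    have "(\<Sum>k\<in>K. cnj (u k) * W (r, k)) * cnj (\<Sum>k\<in>K. cnj (u k) * W (r, k))
        = cnj (\<Sum>k\<in>K. cnj (u k) * W (r, k)) * (\<Sum>l\<in>K. cnj (u l) * W (r, l))"
      by (rule mult.commute)
    also have "\<dots> = (\<Sum>k\<in>K. \<Sum>l\<in>K. u k * cnj (u l) * (W (r, l) * cnj (W (r, k))))"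
      by (simp add: sum_product mult_ac)
    finally show "(\<Sum>k\<in>K. \<Sum>l\<in>K. u k * cnj (u l) * (W (r, l) * cnj (W (r, k))))
        = (\<Sum>k\<in>K. cnj (u k) * W (r, k)) * cnj (\<Sum>k\<in>K. cnj (u k) * W (r, k))" by simp
  qed
  also have "\<dots> = complex_of_real (\<Sum>r\<in>R. (cmod (\<Sum>k\<in>K. cnj (u k) * W (r, k)))\<^sup>2)"
    unfolding of_real_sum complex_norm_square ..
  finally show ?thesis unfolding born_def by (simp only: Re_complex_of_real)
qed

lemma commit_eq:
  assumes "finite S"
  shows "commit S p b (x, x') = (if x = x' \<and> x \<in> S then complex_of_real (sqrt (p b x)) else 0)"
proof -
  have "commit S p b (x, x') = (\<Sum>y\<in>S. if y = x then if x = x' then complex_of_real (sqrt (p b x)) else 0 else 0)"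
    unfolding commit_def by (intro sum.cong) (auto simp: basis_def tensor_vec_def)
  then show ?thesis using assms by simp
qed

lemma commit_state_eq:
  assumes "finite S"
  shows "commit_state S p (b, b', x, x') =
    (if b = b' \<and> x = x' \<and> x \<in> S then complex_of_real (sqrt (p b x) / sqrt 2) else 0)"
  unfolding commit_state_def
  by (cases b; cases b') (auto simp: bits_def tensor_vec_def basis_def commit_eq[OF assms])

lemma finite_bits: "finite bits" and mem_bits: "b \<in> bits"
  by (cases b; simp add: bits_def)+

lemma commit_state_unit:
  assumes fin: "finite S" and p: "p 0 \<in> Prob S" "p 1 \<in> Prob S"
  shows "(\<Sum>k\<in>bits \<times> bits \<times> S \<times> S. commit_state S p k * cnj (commit_state S p k)) = 1"
proof -
  have p': "p b \<in> Prob S" for b using p by (cases b) auto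
  have "(\<Sum>k\<in>bits \<times> bits \<times> S \<times> S. commit_state S p k * cnj (commit_state S p k))
     = (\<Sum>b\<in>bits. \<Sum>b'\<in>bits. \<Sum>x\<in>S. \<Sum>x'\<in>S. if x' = x then if b' = b then complex_of_real (p b x / 2) else 0 else 0)"
    unfolding sum.cartesian_product'
    using p' by (intro sum.cong refl)
      (auto simp: commit_state_eq[OF fin] Prob_def simp flip: of_real_mult)
  also have "\<dots> = (\<Sum>b\<in>bits. \<Sum>b'\<in>bits. if b' = b then \<Sum>x\<in>S. complex_of_real (p b x / 2) else 0)"
    using fin by (intro sum.cong refl) simp
  also have "\<dots> = (\<Sum>b\<in>bits. complex_of_real ((\<Sum>x\<in>S. p b x) / 2))"
    using finite_bits by (simp add: mem_bits sum_divide_distrib)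
  also have "\<dots> = 1"
    using p' by (simp add: Prob_def bits_def)
  finally show ?thesis .
qed

text \<open>
  Outcome \<open>0\<close> accepts exactly when both bit registers show the same \<open>c\<close> and the other two registers
  are in the commitment state of \<open>c\<close>. That state is supported on the diagonal, so only the amplitudes
  at labels \<open>(c, c, x, x)\<close> contribute.
\<close>

lemma born_accept:
  fixes R :: "'r set" and S :: "'s set"
  assumes fin: "finite R" "finite S"
  shows "born (R \<times> (bits \<times> bits \<times> S \<times> S)) (ident \<otimes>\<^sub>o accept S p 0) (mixture Ws)
    = (\<Sum>W\<leftarrow>Ws. \<Sum>c\<in>bits. \<Sum>r\<in>R. (cmod (\<Sum>x\<in>S. complex_of_real (sqrt (p c x)) * W (r, (c, c, x, x))))\<^sup>2)"
proof -
  define u where "u c = basis c \<otimes>\<^sub>v basis c \<otimes>\<^sub>v commit S p c" for c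
  have ident_accept: "(ident \<otimes>\<^sub>o accept S p 0) i j = (\<Sum>c\<in>bits. (ident \<otimes>\<^sub>o outer (u c)) i j)"
    for i j :: "'r \<times> bit \<times> bit \<times> 's \<times> 's"
    by (cases i; cases j) (simp only: tensor_op_def[of ident] accept_def outer_tensor u_def sum_distrib_left case_prod_conv add_0_right)
  have "born (R \<times> (bits \<times> bits \<times> S \<times> S)) (ident \<otimes>\<^sub>o accept S p 0) \<rho>
      = (\<Sum>c\<in>bits. born (R \<times> (bits \<times> bits \<times> S \<times> S)) (ident \<otimes>\<^sub>o outer (u c)) \<rho>)" for \<rho>
    unfolding born_def ident_accept by (simp add: bits_def sum.distrib distrib_right)
  moreover have "(\<Sum>k\<in>bits \<times> bits \<times> S \<times> S. cnj (u c k) * W (r, k))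
      = (\<Sum>x\<in>S. complex_of_real (sqrt (p c x)) * W (r, (c, c, x, x)))" for c and r :: 'r and W
  proof -
    have "(\<Sum>k\<in>bits \<times> bits \<times> S \<times> S. cnj (u c k) * W (r, k))
        = (\<Sum>b\<in>bits. if b = c then \<Sum>b'\<in>bits. if b' = c then \<Sum>x\<in>S. \<Sum>x'\<in>S. if x' = x then
             complex_of_real (sqrt (p c x)) * W (r, (c, c, x, x)) else 0 else 0 else 0)"
      unfolding sum.cartesian_product'
      by (intro sum.cong refl) (auto simp: u_def tensor_vec_def basis_def commit_eq[OF fin(2)] intro!: sum.cong)
    then show ?thesis using fin finite_bits by (simp add: mem_bits)
  qed
  ultimately show ?thesis
    by (simp add: born_mixture born_ident_outer[OF fin(1)] sum_sum_list_swap)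
qed

section \<open>Boundedness of the cheating probabilities\<close>

lemma alice_prob_bdd_above:
  assumes fin: "finite A" "finite B" and \<beta>: "\<beta> 0 \<in> Prob B" "\<beta> 1 \<in> Prob B"
  shows "bdd_above {alice_prob A B \<alpha> \<beta> d \<sigma> d' Ks Ms r | d \<sigma> d' Ks Ms. alice_strategy A B d \<sigma> d' Ks Ms}"
proof -
  let ?C = "\<Sum>k\<in>bits \<times> bits \<times> A \<times> A. \<Sum>l\<in>bits \<times> bits \<times> A \<times> A. cmod (measurement A \<alpha> r k l)"
  have "alice_prob A B \<alpha> \<beta> d \<sigma> d' Ks Ms r \<le> ?C"
    if strategy: "alice_strategy A B d \<sigma> d' Ks Ms" for d \<sigma> d' Ks Ms
    unfolding alice_prob_def
  proof (rule povm_outcome_bound)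
    have \<sigma>: "density (A \<times> {..<d}) \<sigma>"
      and op: "quantum_operation ({..<d} \<times> B) (bits \<times> A \<times> {..<d'}) Ks"
      using strategy by (auto simp: alice_strategy_def)
    show "finite ({..<d'} \<times> bits \<times> B)" "finite (bits \<times> bits \<times> A \<times> A)"
      using fin by (auto simp: finite_bits)
    show "povm ({..<d'} \<times> bits \<times> B) Ms"
      using strategy by (simp add: alice_strategy_def)
    have \<rho>0: "density ((A \<times> {..<d}) \<times> (bits \<times> bits \<times> B \<times> B)) (\<sigma> \<otimes>\<^sub>o outer (commit_state B \<beta>))"
      using fin \<sigma> commit_state_unit[OF fin(2) \<beta>] by (intro density_tensor_outer) auto
    have \<rho>1: "density (({..<d} \<times> B) \<times> (A \<times> bits \<times> bits \<times> B))
        (reorder (\<lambda>((w, y), (x, b, b', y')). ((x, w), (b, b', y, y'))) (\<sigma> \<otimes>\<^sub>o outer (commit_state B \<beta>)))"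
      by (rule density_reorder[OF bij_betw_byWitness[where f' = "\<lambda>((x, w), (b, b', y, y')). ((w, y), (x, b, b', y'))"] _ \<rho>0])
        (use fin in \<open>auto simp: finite_bits\<close>)
    show "density (({..<d'} \<times> bits \<times> B) \<times> (bits \<times> bits \<times> A \<times> A)) (alice_final A B \<beta> d \<sigma> Ks)"
      unfolding alice_final_def Let_def
      by (rule density_reorder[OF bij_betw_byWitness[where f' = "\<lambda>((a', x', w), (x, b, b', y')). ((w, b', y'), (b, a', x, x'))"]
            _ density_apply_op[OF _ _ op \<rho>1]])
        (use fin in \<open>auto simp: finite_bits\<close>)
  qed
  then show ?thesis by (auto intro!: bdd_aboveI[where M = ?C])
qed

lemma bob_prob_bdd_above:
  assumes fin: "finite A" "finite B" and \<alpha>: "\<alpha> 0 \<in> Prob A" "\<alpha> 1 \<in> Prob A"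
  shows "bdd_above {bob_prob A B \<alpha> \<beta> d \<sigma> d' Ks d'' Ls Ms r | d \<sigma> d' Ks d'' Ls Ms.
            bob_strategy A B d \<sigma> d' Ks d'' Ls Ms}"
proof -
  let ?C = "\<Sum>k\<in>bits \<times> bits \<times> B \<times> B. \<Sum>l\<in>bits \<times> bits \<times> B \<times> B. cmod (measurement B \<beta> r k l)"
  have "bob_prob A B \<alpha> \<beta> d \<sigma> d' Ks d'' Ls Ms r \<le> ?C"
    if strategy: "bob_strategy A B d \<sigma> d' Ks d'' Ls Ms" for d \<sigma> d' Ks d'' Ls Ms
    unfolding bob_prob_def
  proof (rule povm_outcome_bound)
    have \<sigma>: "density {..<d} \<sigma>"
      and op1: "quantum_operation ({..<d} \<times> A) (B \<times> {..<d'}) Ks"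
      and op2: "quantum_operation ({..<d'} \<times> bits \<times> A) (bits \<times> B \<times> {..<d''}) Ls"
      using strategy by (auto simp: bob_strategy_def)
    show "finite {..<d''}" "finite (bits \<times> bits \<times> B \<times> B)"
      using fin by (auto simp: finite_bits)
    show "povm {..<d''} Ms"
      using strategy by (simp add: bob_strategy_def)
    have \<rho>0: "density ({..<d} \<times> (bits \<times> bits \<times> A \<times> A)) (\<sigma> \<otimes>\<^sub>o outer (commit_state A \<alpha>))"
      using fin \<sigma> commit_state_unit[OF fin(1) \<alpha>] by (intro density_tensor_outer) auto
    have \<rho>1: "density (({..<d} \<times> A) \<times> (bits \<times> bits \<times> A))
        (reorder (\<lambda>((w, x), (a, a', x')). (w, (a, a', x, x'))) (\<sigma> \<otimes>\<^sub>o outer (commit_state A \<alpha>)))"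
      by (rule density_reorder[OF bij_betw_byWitness[where f' = "\<lambda>(w, (a, a', x, x')). ((w, x), (a, a', x'))"] _ \<rho>0])
        (use fin in \<open>auto simp: finite_bits\<close>)
    have \<rho>3: "density (({..<d'} \<times> bits \<times> A) \<times> (B \<times> bits))
        (reorder (\<lambda>((w, a', x'), (y, a)). ((y, w), (a, a', x'))) (apply_op ({..<d} \<times> A) Ks
          (reorder (\<lambda>((w, x), (a, a', x')). (w, (a, a', x, x'))) (\<sigma> \<otimes>\<^sub>o outer (commit_state A \<alpha>)))))"
      by (rule density_reorder[OF bij_betw_byWitness[where f' = "\<lambda>((y, w), (a, a', x')). ((w, a', x'), (y, a))"]
            _ density_apply_op[OF _ _ op1 \<rho>1]])
        (use fin in \<open>auto simp: finite_bits\<close>)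
    show "density ({..<d''} \<times> (bits \<times> bits \<times> B \<times> B)) (bob_final A B \<alpha> d \<sigma> d' Ks Ls)"
      unfolding bob_final_def Let_def
      by (rule density_reorder[OF bij_betw_byWitness[where f' = "\<lambda>((b', y', w), (y, a)). (w, (a, b', y, y'))"]
            _ density_apply_op[OF _ _ op2 \<rho>3]])
        (use fin in \<open>auto simp: finite_bits\<close>)
  qed
  then show ?thesis by (auto intro!: bdd_aboveI[where M = ?C])
qed

section \<open>Measure-and-commit attacks\<close>

lemma density_outer:
  assumes "(\<Sum>i\<in>S. v i * cnj (v i)) = 1"
  shows "density S (outer v)"
proof -
  have "(\<Sum>i\<in>S. \<Sum>j\<in>S. cnj (u i) * outer v i j * u j)
      = complex_of_real ((cmod (\<Sum>i\<in>S. cnj (u i) * v i))\<^sup>2)" for u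
    unfolding complex_norm_square cnj_sum sum_product
    by (simp add: outer_def mult_ac)
  then show ?thesis
    using assms by (simp add: density_def psd_def outer_def del: of_real_power)
qed

lemma povm_ident:
  assumes "finite S"
  shows "povm S [ident]"
  using psd_ident[OF assms] by (simp add: povm_def)

text \<open>
  Alice prepares \<open>\<Sum>\<^sub>x v x e\<^sub>x \<otimes> e\<^sub>x\<close>, sends one half, measures the reply to obtain \<open>y\<close> and opens the
  other half as a commitment to \<open>g y\<close>. Bob then holds a bit \<open>b\<close>, uniformly distributed, with \<open>y\<close>
  distributed according to \<open>\<beta> b\<close>. She succeeds if \<open>b = g y\<close> and her state passes the test against the
  commitment state of \<open>g y\<close>, whose probability is the square of the inner product.
\<close>

lemma alice_attack:
  fixes A :: "'a set" and B :: "'b set" and v :: "'a \<Rightarrow> real" and g :: "'b \<Rightarrow> bit"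
  assumes fin: "finite A" "finite B" and \<beta>: "\<beta> 0 \<in> Prob B" "\<beta> 1 \<in> Prob B"
    and unit: "(\<Sum>x\<in>A. (v x)\<^sup>2) = 1"
  shows "(\<Sum>y\<in>B. \<beta> (g y) y * (\<Sum>x\<in>A. v x * sqrt (\<alpha> (g y) x))\<^sup>2) / 2 \<le> P_A_star A B \<alpha> \<beta> 0"
proof -
  obtain h where h: "bij_betw h {..<card A} A"
    using ex_bij_betw_nat_finite[OF fin(1)] by (auto simp: atLeast0LessThan)
  obtain ys where ys: "set ys = B" "distinct ys"
    using finite_distinct_list[OF fin(2)] by blast
  have h_mem: "h w \<in> A" if "w < card A" for w
    using h that by (auto dest: bij_betwE)
  have h_eq: "h w = h w' \<longleftrightarrow> w = w'" if "w < card A" "w' < card A" for w w'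
    using h that by (auto simp: bij_betw_def inj_on_def)
  (* The workspace is a copy of A, relabelled by h; K y is the branch in which y was measured. *)
  define V :: "('a \<times> nat) vec" where "V = (\<lambda>(x, w). if h w = x then complex_of_real (v x) else 0)"
  define K :: "'b \<Rightarrow> (bit \<times> 'a \<times> nat, nat \<times> 'b) matr" where
    "K y = (\<lambda>t (w, y'). if t = (g y, h w, 0) \<and> y' = y then 1 else 0)" for y
  let ?d = "card A"
  have "(\<Sum>i\<in>A \<times> {..<?d}. V i * cnj (V i)) = (\<Sum>w<?d. \<Sum>x\<in>A. if h w = x then complex_of_real ((v x)\<^sup>2) else 0)"
    unfolding sum.cartesian_product' by (subst sum.swap) (auto simp: V_def power2_eq_square intro!: sum.cong)
  also have "\<dots> = (\<Sum>w<?d. complex_of_real ((v (h w))\<^sup>2))"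
    using fin h_mem by (intro sum.cong) auto
  also have "\<dots> = (\<Sum>x\<in>A. complex_of_real ((v x)\<^sup>2))"
    by (rule sum.reindex_bij_betw[OF h])
  also have "\<dots> = 1" using unit by (simp flip: of_real_sum of_real_power)
  finally have dens: "density (A \<times> {..<?d}) (outer V)"
    by (rule density_outer)
  have op: "quantum_operation ({..<?d} \<times> B) (bits \<times> A \<times> {..<1}) (map K ys)"
    unfolding quantum_operation_def
  proof (intro ballI)
    fix i j assume "i \<in> {..<?d} \<times> B" "j \<in> {..<?d} \<times> B"
    then obtain w y w' y' where i: "i = (w, y)" "w < ?d" "y \<in> B" and j: "j = (w', y')" "w' < ?d" "y' \<in> B"
      by auto
    have "(\<Sum>t\<in>bits \<times> A \<times> {..<1}. cnj (K z t i) * K z t j)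
        = (\<Sum>t\<in>bits \<times> A \<times> {..<1}. if t = (g z, h w, 0 :: nat) then
             if y = z \<and> y' = z \<and> h w = h w' then 1 else 0 else 0)" for z
      by (intro sum.cong) (auto simp: K_def i j)
    also have "\<dots> z = (if z = y then ident i j else 0)" for z
      using fin finite_bits h_mem h_eq i j by (auto simp: mem_bits ident_def)
    finally have "(\<Sum>L\<leftarrow>map K ys. \<Sum>t\<in>bits \<times> A \<times> {..<1}. cnj (L t i) * L t j) =
        (\<Sum>z\<leftarrow>ys. if z = y then ident i j else 0)"
      by (simp add: comp_def)
    also have "\<dots> = (\<Sum>z\<in>B. if z = y then ident i j else 0)"
      using ys by (simp add: sum_list_distinct_conv_sum_set)
    also have "\<dots> = ident i j" using i fin by simp
    finally show "(\<Sum>L\<leftarrow>map K ys. \<Sum>t\<in>bits \<times> A \<times> {..<1}. cnj (L t i) * L t j) = ident i j" .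
  qed
  have strategy: "alice_strategy A B ?d (outer V) 1 (map K ys) [ident]"
    unfolding alice_strategy_def by (intro conjI dens op povm_ident) (simp add: fin finite_bits)
  define W where "W = (\<lambda>((w, y), (x, b, b', y')). V (x, w) * commit_state B \<beta> (b, b', y, y'))"
  define W' where "W' y = (\<lambda>((w, b', y'), (b, a', x, x')). kraus_vec ({..<?d} \<times> B) (K y) W ((a', x', w), (x, b, b', y')))" for y
  have final: "alice_final A B \<beta> ?d (outer V) (map K ys) = mixture (map W' ys)"
    unfolding alice_final_def Let_def outer_tensor
    unfolding outer_mixture reorder_mixture apply_op_mixture
    by (simp add: comp_def W_def W'_def[abs_def] tensor_vec_def case_prod_unfold)
  have amplitude: "W' y (r, (c, c, x, x)) =
      (if c = g y \<and> r = (0, g y, y) then complex_of_real (v x * (sqrt (\<beta> c y) / sqrt 2)) else 0)"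
    if y: "y \<in> B" and x: "x \<in> A" for y r c x
  proof -
    obtain w b' y' where r: "r = (w, b', y')" by (cases r)
    have "x \<in> h ` {..<?d}" using x bij_betw_imp_surj_on[OF h] by simp
    then obtain w0 where w0: "w0 < ?d" "h w0 = x" by auto
    have "W' y (r, (c, c, x, x)) = (\<Sum>s\<in>{..<?d} \<times> B. if s = (w0, y) then
        (if c = g y \<and> r = (0, g y, y) then complex_of_real (v x * (sqrt (\<beta> c y) / sqrt 2)) else 0) else 0)"
      unfolding W'_def r kraus_vec_def case_prod_conv
    proof (rule sum.cong[OF refl])
      fix s assume "s \<in> {..<?d} \<times> B"
      then obtain w1 y1 where s: "s = (w1, y1)" and w1: "w1 < ?d" by blast
      have "h w1 = x \<longleftrightarrow> w1 = w0" using h_eq[OF w1 w0(1)] w0(2) by simp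
      then show "K y (c, x, w) s * W (s, (x, c, b', y')) = (if s = (w0, y) then
        (if c = g y \<and> (w, b', y') = (0, g y, y) then complex_of_real (v x * (sqrt (\<beta> c y) / sqrt 2)) else 0) else 0)"
        using y w0 by (cases "w1 = w0"; cases "y1 = y")
          (simp_all add: s K_def W_def V_def commit_state_eq[OF fin(2)], auto)
    qed
    then show ?thesis using y w0 fin by simp
  qed
  have \<beta>': "\<beta> b \<in> Prob B" for b using \<beta> by (cases b) auto
  have success: "(\<Sum>c\<in>bits. \<Sum>r\<in>{..<1} \<times> bits \<times> B.
      (cmod (\<Sum>x\<in>A. complex_of_real (sqrt (\<alpha> c x)) * W' y (r, (c, c, x, x))))\<^sup>2)
      = \<beta> (g y) y * (\<Sum>x\<in>A. v x * sqrt (\<alpha> (g y) x))\<^sup>2 / 2" if y: "y \<in> B" for y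
  proof -
    have "(cmod (\<Sum>x\<in>A. complex_of_real (sqrt (\<alpha> c x)) * W' y (r, (c, c, x, x))))\<^sup>2
       = (if r = (0, g y, y) then if c = g y then \<beta> (g y) y * (\<Sum>x\<in>A. v x * sqrt (\<alpha> (g y) x))\<^sup>2 / 2 else 0 else 0)"
      for c r
    proof (cases "c = g y \<and> r = (0, g y, y)")
      case True
      then have "(\<Sum>x\<in>A. complex_of_real (sqrt (\<alpha> c x)) * W' y (r, (c, c, x, x)))
          = complex_of_real (\<Sum>x\<in>A. sqrt (\<alpha> (g y) x) * (v x * (sqrt (\<beta> (g y) y) / sqrt 2)))"
        unfolding of_real_sum using amplitude[OF y] by (intro sum.cong refl) simp
      also have "(\<Sum>x\<in>A. sqrt (\<alpha> (g y) x) * (v x * (sqrt (\<beta> (g y) y) / sqrt 2)))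
          = sqrt (\<beta> (g y) y) / sqrt 2 * (\<Sum>x\<in>A. v x * sqrt (\<alpha> (g y) x))"
        by (simp add: sum_distrib_left mult_ac)
      finally show ?thesis
        using True \<beta>'[of "g y"] y
        by (simp add: norm_mult power_mult_distrib power_divide Prob_def
            del: of_real_mult of_real_sum of_real_divide)
    next
      case False
      then show ?thesis using amplitude[OF y] by auto
    qed
    then show ?thesis using fin finite_bits y by (simp add: mem_bits)
  qed
  have "alice_prob A B \<alpha> \<beta> ?d (outer V) 1 (map K ys) [ident] (Some 0)
     = (\<Sum>y\<leftarrow>ys. \<Sum>c\<in>bits. \<Sum>r\<in>{..<1} \<times> bits \<times> B.
      (cmod (\<Sum>x\<in>A. complex_of_real (sqrt (\<alpha> c x)) * W' y (r, (c, c, x, x))))\<^sup>2)"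
    unfolding alice_prob_def final measurement_def
    using born_accept[of "{..<1::nat} \<times> bits \<times> B" A \<alpha> "map W' ys"] fin finite_bits
    by (simp add: comp_def)
  also have "\<dots> = (\<Sum>y\<in>B. \<beta> (g y) y * (\<Sum>x\<in>A. v x * sqrt (\<alpha> (g y) x))\<^sup>2 / 2)"
    using ys success by (simp only: sum_list_distinct_conv_sum_set cong: sum.cong)
  finally have "(\<Sum>y\<in>B. \<beta> (g y) y * (\<Sum>x\<in>A. v x * sqrt (\<alpha> (g y) x))\<^sup>2) / 2
      = alice_prob A B \<alpha> \<beta> ?d (outer V) 1 (map K ys) [ident] (Some 0)"
    by (simp add: sum_divide_distrib)
  then show ?thesis
    unfolding P_A_star_def using strategy
    by (intro cSup_upper alice_prob_bdd_above[OF fin \<beta>]) blast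
qed

text \<open>
  Bob measures the message of Alice to obtain \<open>x\<close>, prepares \<open>\<Sum>\<^sub>y v x y e\<^sub>y \<otimes> e\<^sub>y\<close> and sends one half.
  Once \<open>a\<close> is revealed he opens the other half as a commitment to \<open>a\<close>. The bit of Alice then always
  agrees with his, and he succeeds if his state passes the test against the commitment state of \<open>a\<close>.
  The value \<open>x\<close> has distribution \<open>\<alpha> a\<close>.
\<close>

lemma bob_attack:
  fixes A :: "'a set" and B :: "'b set" and v :: "'a \<Rightarrow> 'b \<Rightarrow> real"
  assumes fin: "finite A" "finite B" and \<alpha>: "\<alpha> 0 \<in> Prob A" "\<alpha> 1 \<in> Prob A"
    and unit: "\<And>x. x \<in> A \<Longrightarrow> (\<Sum>y\<in>B. (v x y)\<^sup>2) = 1"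
  shows "(\<Sum>x\<in>A. \<alpha> 0 x * (\<Sum>y\<in>B. v x y * sqrt (\<beta> 0 y))\<^sup>2 + \<alpha> 1 x * (\<Sum>y\<in>B. v x y * sqrt (\<beta> 1 y))\<^sup>2) / 2
    \<le> P_B_star A B \<alpha> \<beta> 0"
proof -
  obtain h where h: "bij_betw h {..<card B} B"
    using ex_bij_betw_nat_finite[OF fin(2)] by (auto simp: atLeast0LessThan)
  obtain k where k: "bij_betw k {..<card A} A"
    using ex_bij_betw_nat_finite[OF fin(1)] by (auto simp: atLeast0LessThan)
  obtain xs where xs: "set xs = A" "distinct xs"
    using finite_distinct_list[OF fin(1)] by blast
  have h_mem: "h w \<in> B" if "w < card B" for w
    using h that by (auto dest: bij_betwE)
  have h_eq: "h w = h w' \<longleftrightarrow> w = w'" if "w < card B" "w' < card B" for w w'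
    using h that by (auto simp: bij_betw_def inj_on_def)
  define h' where "h' = the_inv_into {..<card B} h"
  define k' where "k' = the_inv_into {..<card A} k"
  have h': "h' y < card B" "h (h' y) = y" if "y \<in> B" for y
    using that h bij_betwE[OF bij_betw_the_inv_into[OF h]] f_the_inv_into_f_bij_betw[OF h]
    unfolding h'_def by auto
  have k': "k' x < card A" "k (k' x) = x" if "x \<in> A" for x
    using that k bij_betwE[OF bij_betw_the_inv_into[OF k]] f_the_inv_into_f_bij_betw[OF k]
    unfolding k'_def by auto
  have k'_eq: "k' x = k' x' \<longleftrightarrow> x = x'" if "x \<in> A" "x' \<in> A" for x x'
    using that k' by metis
  (* K x is the branch in which x was measured; it stores the second half, relabelled by h', in the
     workspace. The isometry L copies the revealed bit into the reply, releases the stored half and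
     moves the register A' into the workspace. *)
  define K :: "'a \<Rightarrow> ('b \<times> nat, nat \<times> 'a) matr" where
    "K x = (\<lambda>(y, w) (_, x'). if x' = x \<and> w = h' y then complex_of_real (v x y) else 0)" for x
  define L :: "(bit \<times> 'b \<times> nat, nat \<times> bit \<times> 'a) matr" where
    "L = (\<lambda>t (w, a, x). if t = (a, h w, k' x) then 1 else 0)"
  let ?d' = "card B" and ?d'' = "card A"
  have dens: "density {..<1} (outer (\<lambda>_ :: nat. 1))"
    by (rule density_outer) simp
  have op1: "quantum_operation ({..<1} \<times> A) (B \<times> {..<?d'}) (map K xs)"
    unfolding quantum_operation_def
  proof (intro ballI)
    fix i j :: "nat \<times> 'a" assume "i \<in> {..<1} \<times> A" "j \<in> {..<1} \<times> A"
    then obtain x x' where i: "i = (0, x)" "x \<in> A" and j: "j = (0, x')" "x' \<in> A"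
      by auto
    have "(\<Sum>t\<in>B \<times> {..<?d'}. cnj (K z t i) * K z t j) = (if z = x then ident i j else 0)" if "z \<in> A" for z
    proof -
      have "(\<Sum>t\<in>B \<times> {..<?d'}. cnj (K z t i) * K z t j) = (\<Sum>y\<in>B. \<Sum>w<?d'. if w = h' y then
         if x = z \<and> x' = z then complex_of_real ((v z y)\<^sup>2) else 0 else 0)"
        unfolding sum.cartesian_product'
        by (intro sum.cong) (auto simp: K_def i j power2_eq_square)
      also have "\<dots> = (\<Sum>y\<in>B. if x = z \<and> x' = z then complex_of_real ((v z y)\<^sup>2) else 0)"
        using h' by (intro sum.cong) auto
      also have "\<dots> = (if x = z \<and> x' = z then complex_of_real (\<Sum>y\<in>B. (v z y)\<^sup>2) else 0)"
        by (auto intro!: sum.neutral)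
      also have "\<dots> = (if z = x then ident i j else 0)"
        using unit[OF that] by (auto simp: ident_def i j simp del: of_real_sum)
      finally show ?thesis .
    qed
    then have "(\<Sum>M\<leftarrow>map K xs. \<Sum>t\<in>B \<times> {..<?d'}. cnj (M t i) * M t j)
        = (\<Sum>z\<in>A. if z = x then ident i j else 0)"
      using xs by (simp add: sum_list_distinct_conv_sum_set comp_def)
    also have "\<dots> = ident i j" using i fin by simp
    finally show "(\<Sum>M\<leftarrow>map K xs. \<Sum>t\<in>B \<times> {..<?d'}. cnj (M t i) * M t j) = ident i j" .
  qed
  have op2: "quantum_operation ({..<?d'} \<times> bits \<times> A) (bits \<times> B \<times> {..<?d''}) [L]"
    unfolding quantum_operation_def
  proof (intro ballI)
    fix i j assume "i \<in> {..<?d'} \<times> bits \<times> A" "j \<in> {..<?d'} \<times> bits \<times> A"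
    then obtain w a x w' a' x' where i: "i = (w, a, x)" "w < ?d'" "x \<in> A"
      and j: "j = (w', a', x')" "w' < ?d'" "x' \<in> A"
      by auto
    have "(\<Sum>t\<in>bits \<times> B \<times> {..<?d''}. cnj (L t i) * L t j)
        = (\<Sum>t\<in>bits \<times> B \<times> {..<?d''}. if t = (a, h w, k' x) then
             if a = a' \<and> h w = h w' \<and> k' x = k' x' then 1 else 0 else 0)"
      by (intro sum.cong) (auto simp: L_def i j)
    also have "\<dots> = ident i j"
      using fin finite_bits i j h_mem k' by (auto simp: mem_bits ident_def h_eq k'_eq)
    finally show "(\<Sum>M\<leftarrow>[L]. \<Sum>t\<in>bits \<times> B \<times> {..<?d''}. cnj (M t i) * M t j) = ident i j"
      by simp
  qed
  have strategy: "bob_strategy A B 1 (outer (\<lambda>_. 1)) ?d' (map K xs) ?d'' [L] [ident]"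
    unfolding bob_strategy_def using dens op1 op2 povm_ident[of "{..<?d''}"] by simp
  define W1 where "W1 = (\<lambda>((w :: nat, x), (a, a', x')). commit_state A \<alpha> (a, a', x, x'))"
  define W2 where "W2 x = (\<lambda>((w, a', x'), (y, a)). kraus_vec ({..<1} \<times> A) (K x) W1 ((y, w), (a, a', x')))" for x
  define W' where "W' x = (\<lambda>(w, (a, b', y, y')). kraus_vec ({..<?d'} \<times> bits \<times> A) L (W2 x) ((b', y', w), (y, a)))" for x
  have final: "bob_final A B \<alpha> 1 (outer (\<lambda>_. 1)) ?d' (map K xs) [L] = mixture (map W' xs)"
    unfolding bob_final_def Let_def outer_tensor
    unfolding outer_mixture reorder_mixture apply_op_mixture
    by (simp add: comp_def W1_def W2_def[abs_def] W'_def[abs_def] tensor_vec_def case_prod_unfold)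
  have W2_eq: "W2 x ((w, a', x'), (y, a)) = (if a' = a \<and> x' = x \<and> w = h' y then
       complex_of_real (v x y * (sqrt (\<alpha> a x) / sqrt 2)) else 0)" if x: "x \<in> A" for x w a' x' y a
  proof -
    have "W2 x ((w, a', x'), (y, a)) = (\<Sum>s\<in>{..<1} \<times> A. if s = (0 :: nat, x) then
      (if a' = a \<and> x' = x \<and> w = h' y then complex_of_real (v x y * (sqrt (\<alpha> a x) / sqrt 2)) else 0) else 0)"
      unfolding W2_def kraus_vec_def case_prod_conv
      using x by (intro sum.cong refl) (auto simp: K_def W1_def commit_state_eq[OF fin(1)] split: if_splits)
    then show ?thesis using x fin by simp
  qed
  have amplitude: "W' x (r, (c, c, y, y)) =
      (if r = k' x then complex_of_real (v x y * (sqrt (\<alpha> c x) / sqrt 2)) else 0)"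
    if x: "x \<in> A" and y: "y \<in> B" for x r c y
  proof -
    have "W' x (r, (c, c, y, y)) = (\<Sum>s\<in>{..<?d'} \<times> bits \<times> A. if s = (h' y, c, x) then
        (if r = k' x then complex_of_real (v x y * (sqrt (\<alpha> c x) / sqrt 2)) else 0) else 0)"
      unfolding W'_def kraus_vec_def case_prod_conv
      using x y h' by (intro sum.cong refl) (auto simp: L_def W2_eq split: if_splits)
    then show ?thesis using x y fin finite_bits h' by (simp add: mem_bits)
  qed
  have \<alpha>': "\<alpha> b \<in> Prob A" for b using \<alpha> by (cases b) auto
  have success: "(\<Sum>r<?d''. (cmod (\<Sum>y\<in>B. complex_of_real (sqrt (\<beta> c y)) * W' x (r, (c, c, y, y))))\<^sup>2)
      = \<alpha> c x * (\<Sum>y\<in>B. v x y * sqrt (\<beta> c y))\<^sup>2 / 2" if x: "x \<in> A" for x c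
  proof -
    have "(cmod (\<Sum>y\<in>B. complex_of_real (sqrt (\<beta> c y)) * W' x (r, (c, c, y, y))))\<^sup>2
       = (if r = k' x then \<alpha> c x * (\<Sum>y\<in>B. v x y * sqrt (\<beta> c y))\<^sup>2 / 2 else 0)" for r
    proof (cases "r = k' x")
      case True
      then have "(\<Sum>y\<in>B. complex_of_real (sqrt (\<beta> c y)) * W' x (r, (c, c, y, y)))
          = complex_of_real (\<Sum>y\<in>B. sqrt (\<beta> c y) * (v x y * (sqrt (\<alpha> c x) / sqrt 2)))"
        unfolding of_real_sum using amplitude[OF x] by (intro sum.cong refl) simp
      also have "(\<Sum>y\<in>B. sqrt (\<beta> c y) * (v x y * (sqrt (\<alpha> c x) / sqrt 2)))
          = sqrt (\<alpha> c x) / sqrt 2 * (\<Sum>y\<in>B. v x y * sqrt (\<beta> c y))"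
        by (simp add: sum_distrib_left mult_ac)
      finally show ?thesis
        using True \<alpha>'[of c] x
        by (simp add: norm_mult power_mult_distrib power_divide Prob_def
            del: of_real_mult of_real_sum of_real_divide)
    next
      case False
      then show ?thesis using amplitude[OF x] by auto
    qed
    then show ?thesis using k'[OF x] by simp
  qed
  have "bob_prob A B \<alpha> \<beta> 1 (outer (\<lambda>_. 1)) ?d' (map K xs) ?d'' [L] [ident] (Some 0)
     = (\<Sum>x\<leftarrow>xs. \<Sum>c\<in>bits. \<Sum>r<?d''.
      (cmod (\<Sum>y\<in>B. complex_of_real (sqrt (\<beta> c y)) * W' x (r, (c, c, y, y))))\<^sup>2)"
    unfolding bob_prob_def final measurement_def
    using born_accept[of "{..<?d''}" B \<beta> "map W' xs"] fin
    by (simp add: comp_def)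
  also have "\<dots> = (\<Sum>x\<in>A. \<Sum>c\<in>bits. \<alpha> c x * (\<Sum>y\<in>B. v x y * sqrt (\<beta> c y))\<^sup>2 / 2)"
    using xs success by (simp only: sum_list_distinct_conv_sum_set cong: sum.cong)
  finally have "(\<Sum>x\<in>A. \<alpha> 0 x * (\<Sum>y\<in>B. v x y * sqrt (\<beta> 0 y))\<^sup>2 + \<alpha> 1 x * (\<Sum>y\<in>B. v x y * sqrt (\<beta> 1 y))\<^sup>2) / 2
      = bob_prob A B \<alpha> \<beta> 1 (outer (\<lambda>_. 1)) ?d' (map K xs) ?d'' [L] [ident] (Some 0)"
    by (simp add: sum_divide_distrib bits_def add_divide_distrib)
  then show ?thesis
    unfolding P_B_star_def using strategy
    by (intro cSup_upper bob_prob_bdd_above[OF fin \<alpha>]) blast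
qed

section \<open>Overlap and common mass of two distributions\<close>

text \<open>
  The square root of the fidelity of \<open>p 0\<close> and \<open>p 1\<close>, which is also the inner product of the two
  commitment states.
\<close>

definition overlap :: "'i set \<Rightarrow> (bit \<Rightarrow> 'i \<Rightarrow> real) \<Rightarrow> real" where
  "overlap S p = (\<Sum>x\<in>S. sqrt (p 0 x) * sqrt (p 1 x))"

text \<open>
  One minus the total variation distance of \<open>p 0\<close> and \<open>p 1\<close>.
\<close>

definition common_mass :: "'i set \<Rightarrow> (bit \<Rightarrow> 'i \<Rightarrow> real) \<Rightarrow> real" where
  "common_mass S p = (\<Sum>x\<in>S. min (p 0 x) (p 1 x))"

lemma overlap_nonneg:
  assumes "p 0 \<in> Prob S" "p 1 \<in> Prob S"
  shows "0 \<le> overlap S p"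
  using assms by (auto simp: overlap_def Prob_def intro!: sum_nonneg)

lemma sum_sqrt_square:
  assumes "q \<in> Prob S"
  shows "(\<Sum>x\<in>S. (sqrt (q x))\<^sup>2) = 1"
proof -
  have "(\<Sum>x\<in>S. (sqrt (q x))\<^sup>2) = (\<Sum>x\<in>S. q x)"
    using assms by (intro sum.cong) (auto simp: Prob_def)
  then show ?thesis using assms by (simp add: Prob_def)
qed

lemma sum_max_eq:
  assumes "p 0 \<in> Prob S" "p 1 \<in> Prob S"
  shows "(\<Sum>x\<in>S. max (p 0 x) (p 1 x)) = 2 - common_mass S p"
proof -
  have "(\<Sum>x\<in>S. max (p 0 x) (p 1 x)) + common_mass S p = (\<Sum>x\<in>S. p 0 x + p 1 x)"
    unfolding common_mass_def sum.distrib[symmetric] by (intro sum.cong) auto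
  then show ?thesis using assms by (simp add: sum.distrib Prob_def)
qed

lemma min_le_sqrt_mult_sqrt:
  assumes "0 \<le> a" "0 \<le> (b::real)"
  shows "min a b \<le> sqrt a * sqrt b"
proof -
  have "(min a b)\<^sup>2 \<le> a * b"
    using assms unfolding power2_eq_square by (intro mult_mono) auto
  then show ?thesis by (metis real_le_rsqrt real_sqrt_mult)
qed

lemma common_mass_le_overlap:
  assumes "p 0 \<in> Prob S" "p 1 \<in> Prob S"
  shows "common_mass S p \<le> overlap S p"
  unfolding common_mass_def overlap_def
  using assms by (intro sum_mono min_le_sqrt_mult_sqrt) (auto simp: Prob_def)

text \<open>
  For \<open>p 0 = (a, 1 - a)\<close> and \<open>p 1 = (b, 1 - b)\<close> with \<open>a \<le> b\<close>, the cross term of the squared overlap is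
  at least \<open>2 a (1 - b)\<close>, since each of its two geometric means dominates the corresponding minimum.
  With this estimate the square is at least \<open>a + (1 - b)\<close>, the common mass. With three or more points
  the inequality fails in general.
\<close>

lemma common_mass_le_overlap_square:
  assumes p: "p 0 \<in> Prob S" "p 1 \<in> Prob S" and two: "card S = 2"
  shows "common_mass S p \<le> (overlap S p)\<^sup>2"
proof -
  obtain s t where S: "S = {s, t}" "s \<noteq> t"
    using two by (auto simp: card_2_iff)
  have key: "min a b + min (1 - a) (1 - b) \<le> (sqrt a * sqrt b + sqrt (1 - a) * sqrt (1 - b))\<^sup>2"
    if "0 \<le> a" "a \<le> b" "b \<le> 1" for a b :: real
  proof -
    have "a * (1 - b) \<le> (sqrt a * sqrt b) * (sqrt (1 - a) * sqrt (1 - b))"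
      using that min_le_sqrt_mult_sqrt[of a b] min_le_sqrt_mult_sqrt[of "1 - a" "1 - b"]
      by (intro mult_mono) auto
    moreover have "(sqrt a * sqrt b + sqrt (1 - a) * sqrt (1 - b))\<^sup>2
       = a * b + (1 - a) * (1 - b) + 2 * ((sqrt a * sqrt b) * (sqrt (1 - a) * sqrt (1 - b)))"
      using that by (simp add: power2_sum power_mult_distrib)
    ultimately have "a * b + (1 - a) * (1 - b) + 2 * (a * (1 - b))
        \<le> (sqrt a * sqrt b + sqrt (1 - a) * sqrt (1 - b))\<^sup>2" by linarith
    moreover have "a * b + (1 - a) * (1 - b) + 2 * (a * (1 - b)) = a + (1 - b)"
      by (simp add: algebra_simps)
    ultimately show ?thesis using that by simp
  qed
  have pt: "p c t = 1 - p c s" "0 \<le> p c s" "p c s \<le> 1" for c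
  proof -
    have "p c \<in> Prob S" using p by (cases c) auto
    then show "p c t = 1 - p c s" "0 \<le> p c s" "p c s \<le> 1"
      using S by (auto simp: Prob_def)
  qed
  show ?thesis
    using key[of "p 0 s" "p 1 s"] key[of "p 1 s" "p 0 s"] pt[of 0] pt[of 1] S
    by (cases "p 0 s \<le> p 1 s") (simp_all add: common_mass_def overlap_def min.commute mult.commute)
qed

section \<open>Lower bounds on the cheating probabilities\<close>

text \<open>
  The unit vector halfway between the two amplitude vectors \<open>\<surd>(p 0)\<close> and \<open>\<surd>(p 1)\<close>. It has the same
  inner product with both, so a commitment in this state can be opened equally well either way.
\<close>

definition bisector :: "'i set \<Rightarrow> (bit \<Rightarrow> 'i \<Rightarrow> real) \<Rightarrow> 'i \<Rightarrow> real" where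
  "bisector S p x = (sqrt (p 0 x) + sqrt (p 1 x)) / sqrt (2 + 2 * overlap S p)"

text \<open>
  The maximum likelihood guess of the bit from one sample; ties go to \<open>0\<close>.
\<close>

definition likelier :: "(bit \<Rightarrow> 'i \<Rightarrow> real) \<Rightarrow> 'i \<Rightarrow> bit" where
  "likelier p x = (if p 1 x \<le> p 0 x then 0 else 1)"

lemma bisector_unit:
  assumes p: "p 0 \<in> Prob S" "p 1 \<in> Prob S"
  shows "(\<Sum>x\<in>S. (bisector S p x)\<^sup>2) = 1"
proof -
  have "(\<Sum>x\<in>S. (sqrt (p 0 x) + sqrt (p 1 x))\<^sup>2) = 2 + 2 * overlap S p"
    using sum_sqrt_square[OF p(1)] sum_sqrt_square[OF p(2)]
    by (simp add: power2_sum sum.distrib overlap_def sum_distrib_left mult.assoc)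
  then show ?thesis
    using overlap_nonneg[OF p]
    by (simp add: bisector_def power_divide flip: sum_divide_distrib)
qed

lemma bisector_overlap:
  assumes p: "p 0 \<in> Prob S" "p 1 \<in> Prob S"
  shows "(\<Sum>x\<in>S. bisector S p x * sqrt (p c x))\<^sup>2 = (1 + overlap S p) / 2"
proof -
  have "(\<Sum>x\<in>S. (sqrt (p 0 x) + sqrt (p 1 x)) * sqrt (p c x)) = 1 + overlap S p"
  proof -
    have "p c \<in> Prob S" using p by (cases c) auto
    moreover have "(sqrt (p 0 x) + sqrt (p 1 x)) * sqrt (p c x) = (sqrt (p c x))\<^sup>2 + sqrt (p 0 x) * sqrt (p 1 x)" for x
      by (cases c) (auto simp: power2_eq_square distrib_right simp del: real_sqrt_mult_self)
    ultimately show ?thesis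
      by (simp only: sum.distrib sum_sqrt_square overlap_def)
  qed
  then have "(\<Sum>x\<in>S. bisector S p x * sqrt (p c x)) = (1 + overlap S p) / sqrt (2 + 2 * overlap S p)"
    by (simp add: bisector_def flip: sum_divide_distrib)
  then show ?thesis
    using overlap_nonneg[OF p]
    by (simp add: power_divide) (simp add: field_simps power2_eq_square)
qed

lemma alice_lower_bound:
  assumes fin: "finite A" "finite B" and \<alpha>: "\<alpha> 0 \<in> Prob A" "\<alpha> 1 \<in> Prob A"
    and \<beta>: "\<beta> 0 \<in> Prob B" "\<beta> 1 \<in> Prob B"
  shows "(2 - common_mass B \<beta>) * (1 + overlap A \<alpha>) / 4 \<le> P_A_star A B \<alpha> \<beta> 0"
proof -
  have mass: "(\<Sum>y\<in>B. \<beta> (likelier \<beta> y) y) = 2 - common_mass B \<beta>"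
    unfolding sum_max_eq[OF \<beta>, symmetric] by (intro sum.cong) (auto simp: likelier_def)
  have "(2 - common_mass B \<beta>) * ((1 + overlap A \<alpha>) / 2) / 2 \<le> P_A_star A B \<alpha> \<beta> 0"
    using alice_attack[OF fin \<beta> bisector_unit[OF \<alpha>], of "likelier \<beta>" \<alpha>]
    by (simp only: bisector_overlap[OF \<alpha>] sum_distrib_right[symmetric] mass)
  then show ?thesis by simp
qed

lemma bob_lower_bound_ignoring:
  assumes fin: "finite A" "finite B" and \<alpha>: "\<alpha> 0 \<in> Prob A" "\<alpha> 1 \<in> Prob A"
    and \<beta>: "\<beta> 0 \<in> Prob B" "\<beta> 1 \<in> Prob B"
  shows "(1 + overlap B \<beta>) / 2 \<le> P_B_star A B \<alpha> \<beta> 0"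
proof -
  have mass: "(\<Sum>x\<in>A. \<alpha> 0 x) = 1" "(\<Sum>x\<in>A. \<alpha> 1 x) = 1"
    using \<alpha> by (auto simp: Prob_def)
  have "(1 * ((1 + overlap B \<beta>) / 2) + 1 * ((1 + overlap B \<beta>) / 2)) / 2 \<le> P_B_star A B \<alpha> \<beta> 0"
    using bob_attack[OF fin \<alpha> bisector_unit[OF \<beta>], of \<beta>]
    by (simp only: bisector_overlap[OF \<beta>] sum.distrib sum_distrib_right[symmetric] mass)
  then show ?thesis by simp
qed

text \<open>
  Only the event that the guess is right is counted; the chance that a wrong commitment is accepted
  nevertheless is dropped.
\<close>

lemma bob_lower_bound_measuring:
  assumes fin: "finite A" "finite B" and \<alpha>: "\<alpha> 0 \<in> Prob A" "\<alpha> 1 \<in> Prob A"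
    and \<beta>: "\<beta> 0 \<in> Prob B" "\<beta> 1 \<in> Prob B"
  shows "1 - common_mass A \<alpha> / 2 \<le> P_B_star A B \<alpha> \<beta> 0"
proof -
  have \<beta>': "\<beta> b \<in> Prob B" for b using \<beta> by (cases b) auto
  have self: "(\<Sum>y\<in>B. sqrt (\<beta> b y) * sqrt (\<beta> b y)) = 1" for b
    using sum_sqrt_square[OF \<beta>'] by (simp only: power2_eq_square)
  have "2 - common_mass A \<alpha> = (\<Sum>x\<in>A. max (\<alpha> 0 x) (\<alpha> 1 x))"
    by (rule sum_max_eq[OF \<alpha>, symmetric])
  also have "\<dots> \<le> (\<Sum>x\<in>A. \<alpha> 0 x * (\<Sum>y\<in>B. sqrt (\<beta> (likelier \<alpha> x) y) * sqrt (\<beta> 0 y))\<^sup>2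
        + \<alpha> 1 x * (\<Sum>y\<in>B. sqrt (\<beta> (likelier \<alpha> x) y) * sqrt (\<beta> 1 y))\<^sup>2)"
  proof (rule sum_mono)
    fix x assume "x \<in> A"
    then have "0 \<le> \<alpha> 0 x * q\<^sup>2" "0 \<le> \<alpha> 1 x * q\<^sup>2" for q
      using \<alpha> by (auto simp: Prob_def)
    then show "max (\<alpha> 0 x) (\<alpha> 1 x) \<le> \<alpha> 0 x * (\<Sum>y\<in>B. sqrt (\<beta> (likelier \<alpha> x) y) * sqrt (\<beta> 0 y))\<^sup>2
        + \<alpha> 1 x * (\<Sum>y\<in>B. sqrt (\<beta> (likelier \<alpha> x) y) * sqrt (\<beta> 1 y))\<^sup>2"
      by (simp add: likelier_def self max_def del: real_sqrt_mult_self)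
  qed
  finally show ?thesis
    using bob_attack[OF fin \<alpha>, of "\<lambda>x y. sqrt (\<beta> (likelier \<alpha> x) y)" \<beta>, OF sum_sqrt_square[OF \<beta>']]
    by linarith
qed

section \<open>The trade-off between the two parties\<close>

theorem mainTheorem5:
  fixes A :: "'a set" and B :: "'b set"
    and \<alpha> :: "bit \<Rightarrow> 'a \<Rightarrow> real" and \<beta> :: "bit \<Rightarrow> 'b \<Rightarrow> real"
  assumes "finite A" and "finite B"
    and "\<alpha> 0 \<in> Prob A" and "\<alpha> 1 \<in> Prob A"
    and "\<beta> 0 \<in> Prob B" and "\<beta> 1 \<in> Prob B"
  shows "(card A = 2 \<and> card B = 2 \<longrightarrow>
            max (P_A_star A B \<alpha> \<beta> 0) (P_B_star A B \<alpha> \<beta> 0) \<ge> 0.7487 \<and> bias A B \<alpha> \<beta> \<ge> 0.2487)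
       \<and> (card B = 2 \<and> card A \<noteq> 2 \<longrightarrow>
            max (P_A_star A B \<alpha> \<beta> 0) (P_B_star A B \<alpha> \<beta> 0) \<ge> 0.7140)
       \<and> (card A = 2 \<and> card B \<noteq> 2 \<longrightarrow>
            max (P_A_star A B \<alpha> \<beta> 0) (P_B_star A B \<alpha> \<beta> 0) \<ge> 0.7040)"
proof -
  define P where "P = max (P_A_star A B \<alpha> \<beta> 0) (P_B_star A B \<alpha> \<beta> 0)"
  define a b m n where "a = overlap A \<alpha>" and "b = overlap B \<beta>"
    and "m = common_mass A \<alpha>" and "n = common_mass B \<beta>"
  have b0: "0 \<le> b"
    using overlap_nonneg assms by (auto simp: b_def)
  have alice: "(2 - n) * (1 + a) \<le> 4 * P"
    using alice_lower_bound[of A B \<alpha> \<beta>] assms by (simp add: P_def a_def n_def)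
  have b_le: "b \<le> 2 * P - 1"
    using bob_lower_bound_ignoring[of A B \<alpha> \<beta>] assms by (simp add: P_def b_def)
  have m_ge: "2 - 2 * P \<le> m"
    using bob_lower_bound_measuring[of A B \<alpha> \<beta>] assms by (simp add: P_def m_def)
  have m_le: "m \<le> a" and n_le: "n \<le> b"
    using common_mass_le_overlap assms by (auto simp: a_def b_def m_def n_def)
  have m_le2: "m \<le> a\<^sup>2" if "card A = 2"
    using common_mass_le_overlap_square assms that by (auto simp: a_def m_def)
  have n_le2: "n \<le> b\<^sup>2" if "card B = 2"
    using common_mass_le_overlap_square assms that by (auto simp: b_def n_def)
  have a0: "0 \<le> a"
    using overlap_nonneg assms by (auto simp: a_def)
  (* The bound on Alice is decreasing in n and increasing in a, so bounds on n and a that follow from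
     smallness of P may be substituted into it. *)
  have conflict: False if "n \<le> r" "t \<le> a" "4 * P < (2 - r) * (1 + t)" "r \<le> 2" "0 \<le> t" for r t :: real
  proof -
    have "(2 - r) * (1 + t) \<le> (2 - n) * (1 + a)"
      using that by (intro mult_mono) auto
    then show False using alice that by linarith
  qed
  have both: "0.7487 \<le> P" if "card A = 2" "card B = 2"
  proof (rule ccontr)
    assume P: "\<not> 0.7487 \<le> P"
    (* 0.4974 = 2 * 0.7487 - 1, with square just below 0.2475; 0.7089 is the square root of
       2 - 2 * 0.7487, rounded down. *)
    have "b\<^sup>2 \<le> 0.4974\<^sup>2" using P b_le b0 by (intro power_mono) auto
    moreover have "0.7089\<^sup>2 \<le> a\<^sup>2" using P m_ge m_le2[OF that(1)] by (simp add: power2_eq_square)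
    then have "0.7089 \<le> a" using a0 by (rule power2_le_imp_le)
    ultimately show False
      using conflict[of "0.2475" "0.7089"] n_le2[OF that(2)] P by (simp add: power2_eq_square)
  qed
  have qubit_B: "0.7140 \<le> P" if "card B = 2"
  proof (rule ccontr)
    assume P: "\<not> 0.7140 \<le> P"
    have "b\<^sup>2 \<le> 0.428\<^sup>2" using P b_le b0 by (intro power_mono) auto
    moreover have "0.572 \<le> a" using P m_ge m_le by simp
    ultimately show False
      using conflict[of "0.428\<^sup>2" "0.572"] n_le2[OF that] P by (simp add: power2_eq_square)
  qed
  have qubit_A: "0.7040 \<le> P" if "card A = 2"
  proof (rule ccontr)
    assume P: "\<not> 0.7040 \<le> P"
    (* 0.7694 is the square root of 2 - 2 * 0.7040, rounded down. *)
    have "b \<le> 0.408" using P b_le by simp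
    moreover have "0.7694\<^sup>2 \<le> a\<^sup>2" using P m_ge m_le2[OF that] by (simp add: power2_eq_square)
    then have "0.7694 \<le> a" using a0 by (rule power2_le_imp_le)
    ultimately show False
      using conflict[of "0.408" "0.7694"] n_le P by simp
  qed
  have "P \<le> Max {P_A_star A B \<alpha> \<beta> 0, P_A_star A B \<alpha> \<beta> 1, P_B_star A B \<alpha> \<beta> 0, P_B_star A B \<alpha> \<beta> 1}"
    unfolding P_def by (auto intro: Max_ge)
  then have "P - 1 / 2 \<le> bias A B \<alpha> \<beta>"
    by (simp add: bias_def)
  then show ?thesis
    using both qubit_A qubit_B unfolding P_def[symmetric] by auto
qed

end
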